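(* For any $A\subseteq\mathbb{N}$ there exists an irreflexive interpolable relation $\prec^\ast_A$ on $\mathbb{N}$ such that for any $X\subseteq\mathbb{N}$: $A\leq_T X''$ if and only if there exists a relation on $\mathbb{N}$ that is c.e. relative to $X$ and isomorphic to $\prec^\ast_A$.
   Context: A relation is irreflexive if $x\prec x$ never holds; a transitive relation $\prec$ on $\mathbb{N}$ is interpolable if every initial segment $\{x\mid x\prec y\}$ is directed (non-empty and any two of its elements have a $\prec$-upper bound in it). $X''$ is the double Turing jump of $X$. *)

theory Defs
  imports Main "HOL-Library.Nat_Bijection"
begin

datatype rf = Zero | Succ | Proj nat | Oracle | Comp rf "rf list" | Prec rf rf | Mu rf

inductive eval :: "nat set \<Rightarrow> rf \<Rightarrow> nat list \<Rightarrow> nat \<Rightarrow> bool" for X :: "nat set" where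
  ev_zero: "eval X Zero xs 0"
| ev_succ: "eval X Succ (x # xs) (Suc x)"
| ev_proj: "i < length xs \<Longrightarrow> eval X (Proj i) xs (xs ! i)"
| ev_oracle: "eval X Oracle (x # xs) (if x \<in> X then 1 else 0)"
| ev_comp: "length ys = length gs \<Longrightarrow> (\<forall>i < length gs. eval X (gs ! i) xs (ys ! i))
             \<Longrightarrow> eval X f ys z \<Longrightarrow> eval X (Comp f gs) xs z"
| ev_prec0: "eval X f xs y \<Longrightarrow> eval X (Prec f g) (0 # xs) y"
| ev_precS: "eval X (Prec f g) (n # xs) y \<Longrightarrow> eval X g (n # y # xs) z
             \<Longrightarrow> eval X (Prec f g) (Suc n # xs) z"
| ev_mu: "eval X f (n # xs) 0 \<Longrightarrow> (\<forall>m < n. \<exists>k. eval X f (m # xs) (Suc k))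
             \<Longrightarrow> eval X (Mu f) xs n"

fun code :: "rf \<Rightarrow> nat" where
  "code Zero = prod_encode (0, 0)"
| "code Succ = prod_encode (1, 0)"
| "code (Proj i) = prod_encode (2, i)"
| "code Oracle = prod_encode (3, 0)"
| "code (Comp f gs) = prod_encode (4, prod_encode (code f, list_encode (map code gs)))"
| "code (Prec f g) = prod_encode (5, prod_encode (code f, code g))"
| "code (Mu f) = prod_encode (6, code f)"

definition turing_le :: "nat set \<Rightarrow> nat set \<Rightarrow> bool" where
  "turing_le A X \<longleftrightarrow> (\<exists>t. \<forall>n. eval X t [n] (if n \<in> A then 1 else 0))"

definition jump :: "nat set \<Rightarrow> nat set" where
  "jump X = {n. \<exists>t y. n = code t \<and> eval X t [n] y}"

definition ce_rel_in :: "nat set \<Rightarrow> (nat \<Rightarrow> nat \<Rightarrow> bool) \<Rightarrow> bool" where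
  "ce_rel_in X R \<longleftrightarrow> (\<exists>t. \<forall>x y. R x y \<longleftrightarrow> (\<exists>z. eval X t [x, y] z))"

definition rel_iso :: "(nat \<Rightarrow> nat \<Rightarrow> bool) \<Rightarrow> (nat \<Rightarrow> nat \<Rightarrow> bool) \<Rightarrow> bool" where
  "rel_iso R S \<longleftrightarrow> (\<exists>f. bij f \<and> (\<forall>x y. R x y \<longleftrightarrow> S (f x) (f y)))"

definition interpolable :: "(nat \<Rightarrow> nat \<Rightarrow> bool) \<Rightarrow> bool" where
  "interpolable R \<longleftrightarrow> transp R \<and>
     (\<forall>y. (\<exists>x. R x y) \<and> (\<forall>a b. R a y \<and> R b y \<longrightarrow> (\<exists>c. R c y \<and> R a c \<and> R b c)))"

end

(* For n, consider a "fan": a dense spine without least element, together with n + 1 maximal tips, each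
   of which lies above the same lower cut of the spine. The relation of the theorem is a disjoint union
   of infinitely many copies of each fan with a bounded cut and, for n in the join B of A and its
   complement, also of the fans with n + 1 tips above the whole spine. As the cut of a fan can be
   enlarged at any later time, a Sigma_3(X) definition "for some m, E n m s for all s" of B, with E
   c.e. in X, yields a copy c.e. in X: for each m take a fan with n + 1 tips whose cut is the supremum
   of the l such that E n m s for all s < l. Conversely, that some element x has exactly n + 1 maximal
   elements above it and that they cover everything above x is a Sigma_3(X) property of a relation c.e.
   in X, and it singles out the fans whose tips lie above the whole spine. Hence some
   copy is c.e. in X iff B is Sigma_3(X), that is, iff A is Delta_3(X), that is, A is recursive in X''. *)
theory Submission
  imports Defs Complex_Main "HOL-Library.Infinite_Set"
begin

section \<open>Total functions recursive in an oracle\<close>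

text \<open>Interpolability removes most finite invariants: no element is minimal and every initial
  segment is directed, so nothing can be counted below a point. Maximal elements above a point can
  still be counted, hence n is stored as n + 1 tips. A copy c.e. in X can add pairs but never
  retract them. The order on each spine is therefore fixed and decidable from the start, and the
  only later event is that more spine elements come to lie below the tips. A wrong witness m stops
  at a bounded cut whose place cannot be foreseen. This does no harm, since every bounded cut occurs
  anyway, for every n and infinitely often; infinite multiplicity also makes it irrelevant how many
  m succeed. So the isomorphism type depends on B alone, not on the chosen E. A c.e. copy only gives
  a one-sided bound, namely that B is Sigma_3(X). With the join this bound holds for A and for its
  complement, and X'' can then search for a witness of either side. The levels of the hierarchy are
  tied to jumps by a relativized form of Post's theorem, derived from the evaluation relation
  itself.\<close>

definition recfn :: "nat set \<Rightarrow> nat \<Rightarrow> (nat list \<Rightarrow> nat) \<Rightarrow> bool" where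
  "recfn X k f \<longleftrightarrow> (\<exists>t. \<forall>xs. length xs = k \<longrightarrow> eval X t xs (f xs))"

lemma recfn_cong:
  assumes "recfn X k f" "\<And>xs. length xs = k \<Longrightarrow> f xs = g xs"
  shows "recfn X k g"
  using assms unfolding recfn_def by metis

lemma recfn_zero: "recfn X k (\<lambda>xs. 0)"
  unfolding recfn_def by (blast intro: ev_zero)

lemma recfn_proj: "i < k \<Longrightarrow> recfn X k (\<lambda>xs. xs ! i)"
  unfolding recfn_def by (blast intro: ev_proj)

lemma recfn_comp:
  assumes "recfn X (length gs) f" "\<forall>g \<in> set gs. recfn X k g"
  shows "recfn X k (\<lambda>xs. f (map (\<lambda>g. g xs) gs))"
proof -
  obtain t where t: "\<And>xs. length xs = length gs \<Longrightarrow> eval X t xs (f xs)"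
    using assms(1) unfolding recfn_def by blast
  obtain s where s: "\<And>g xs. g \<in> set gs \<Longrightarrow> length xs = k \<Longrightarrow> eval X (s g) xs (g xs)"
    using assms(2) unfolding recfn_def by metis
  have "eval X (Comp t (map s gs)) xs (f (map (\<lambda>g. g xs) gs))" if "length xs = k" for xs
    by (rule ev_comp[where ys = "map (\<lambda>g. g xs) gs"]) (auto simp: s t that)
  then show ?thesis unfolding recfn_def by blast
qed

lemma recfn_comp1: "recfn X (Suc 0) f \<Longrightarrow> recfn X k g \<Longrightarrow> recfn X k (\<lambda>xs. f [g xs])"
  using recfn_comp[of X "[g]" f k] by simp

lemma recfn_comp2:
  "recfn X (Suc (Suc 0)) f \<Longrightarrow> recfn X k g \<Longrightarrow> recfn X k h \<Longrightarrow> recfn X k (\<lambda>xs. f [g xs, h xs])"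
  using recfn_comp[of X "[g, h]" f k] by simp

lemma recfn_Suc: "recfn X k g \<Longrightarrow> recfn X k (\<lambda>xs. Suc (g xs))"
proof -
  assume g: "recfn X k g"
  have "recfn X (Suc 0) (\<lambda>xs. Suc (hd xs))"
    unfolding recfn_def
    by (rule exI[of _ Succ]) (auto simp: length_Suc_conv intro: ev_succ)
  from recfn_comp1[OF this g] show ?thesis by simp
qed

lemma recfn_oracle: "recfn X k g \<Longrightarrow> recfn X k (\<lambda>xs. if g xs \<in> X then 1 else 0)"
proof -
  assume g: "recfn X k g"
  have "recfn X (Suc 0) (\<lambda>xs. if hd xs \<in> X then 1 else 0)"
    unfolding recfn_def
  proof (intro exI[of _ Oracle] allI impI)
    fix xs :: "nat list" assume "length xs = Suc 0"
    then obtain x where "xs = [x]" by (auto simp: length_Suc_conv)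
    then show "eval X Oracle xs (if hd xs \<in> X then 1 else 0)"
      using ev_oracle[of X x "[]"] by simp
  qed
  from recfn_comp1[OF this g] show ?thesis by simp
qed

lemma recfn_prec:
  assumes "recfn X k f" "recfn X (Suc (Suc k)) h"
  shows "recfn X (Suc k) (\<lambda>xs. rec_nat (f (tl xs)) (\<lambda>n y. h (n # y # tl xs)) (hd xs))"
proof -
  obtain t where t: "\<And>xs. length xs = k \<Longrightarrow> eval X t xs (f xs)"
    using assms(1) unfolding recfn_def by blast
  obtain s where s: "\<And>xs. length xs = Suc (Suc k) \<Longrightarrow> eval X s xs (h xs)"
    using assms(2) unfolding recfn_def by blast
  have *: "eval X (Prec t s) (n # xs) (rec_nat (f xs) (\<lambda>n y. h (n # y # xs)) n)"
    if "length xs = k" for n xs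
  proof (induction n)
    case 0
    show ?case using t[OF that] by (simp add: ev_prec0)
  next
    case (Suc n)
    show ?case using ev_precS[OF Suc s] that by simp
  qed
  show ?thesis
    unfolding recfn_def
    by (rule exI[of _ "Prec t s"]) (auto simp: length_Suc_conv *)
qed

lemma eval_Mu_Least:
  assumes t: "\<And>xs. length xs = Suc k \<Longrightarrow> eval X t xs (f xs)"
    and xs: "length xs = k" and ex: "\<exists>n. f (n # xs) = 0"
  shows "eval X (Mu t) xs (LEAST n. f (n # xs) = 0)"
proof (rule ev_mu)
  let ?n = "LEAST n. f (n # xs) = 0"
  have "f (?n # xs) = 0" using ex by (rule LeastI_ex)
  then show "eval X t (?n # xs) 0" using t[of "?n # xs"] xs by simp
  show "\<forall>m<?n. \<exists>j. eval X t (m # xs) (Suc j)"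
  proof (intro allI impI)
    fix m assume "m < ?n"
    then have "f (m # xs) \<noteq> 0" by (rule not_less_Least)
    then obtain j where "f (m # xs) = Suc j" using not0_implies_Suc by blast
    then show "\<exists>j. eval X t (m # xs) (Suc j)" using t[of "m # xs"] xs by auto
  qed
qed

lemma recfn_mu:
  assumes "recfn X (Suc k) f" "\<And>xs. length xs = k \<Longrightarrow> \<exists>n. f (n # xs) = 0"
  shows "recfn X k (\<lambda>xs. LEAST n. f (n # xs) = 0)"
proof -
  obtain t where t: "\<And>xs. length xs = Suc k \<Longrightarrow> eval X t xs (f xs)"
    using assms(1) unfolding recfn_def by blast
  have "eval X (Mu t) xs (LEAST n. f (n # xs) = 0)" if "length xs = k" for xs
    using eval_Mu_Least[OF t that assms(2)[OF that]] .
  then show ?thesis unfolding recfn_def by blast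
qed

lemma recfn_add: "recfn X k f \<Longrightarrow> recfn X k g \<Longrightarrow> recfn X k (\<lambda>xs. f xs + g xs)"
proof -
  assume f: "recfn X k f" and g: "recfn X k g"
  have "recfn X (Suc (Suc 0)) (\<lambda>xs. xs ! 0 + xs ! 1)"
  proof (rule recfn_cong[OF recfn_prec])
    show "recfn X (Suc 0) (\<lambda>xs. xs ! 0)" by (rule recfn_proj) simp
    show "recfn X (Suc (Suc (Suc 0))) (\<lambda>xs. Suc (xs ! 1))" by (intro recfn_Suc recfn_proj) simp
    fix xs :: "nat list" assume "length xs = Suc (Suc 0)"
    then obtain a b where [simp]: "xs = [a, b]" by (auto simp: length_Suc_conv)
    show "rec_nat (tl xs ! 0) (\<lambda>n y. Suc ((n # y # tl xs) ! 1)) (hd xs) = xs ! 0 + xs ! 1"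
      by (simp, induction a) auto
  qed
  from recfn_comp2[OF this f g] show ?thesis by simp
qed

lemma recfn_diff: "recfn X k f \<Longrightarrow> recfn X k g \<Longrightarrow> recfn X k (\<lambda>xs. f xs - g xs)"
proof -
  assume f: "recfn X k f" and g: "recfn X k g"
  have pred: "recfn X j (\<lambda>xs. h xs - 1)" if h: "recfn X j h" for j h
  proof -
    have "recfn X (Suc 0) (\<lambda>xs. xs ! 0 - 1)"
    proof (rule recfn_cong[OF recfn_prec])
      show "recfn X 0 (\<lambda>xs. 0)" by (rule recfn_zero)
      show "recfn X (Suc (Suc 0)) (\<lambda>xs. xs ! 0)" by (intro recfn_proj) simp
      fix xs :: "nat list" assume "length xs = Suc 0"
      then obtain a where [simp]: "xs = [a]" by (auto simp: length_Suc_conv)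
      show "rec_nat 0 (\<lambda>n y. (n # y # tl xs) ! 0) (hd xs) = xs ! 0 - 1"
        by (cases a) auto
    qed
    from recfn_comp1[OF this h] show ?thesis by simp
  qed
  \<comment> \<open>Primitive recursion runs on the first argument, so the subtrahend has to come
    first; the final composition swaps the arguments back.\<close>
  have "recfn X (Suc (Suc 0)) (\<lambda>xs. xs ! 1 - xs ! 0)"
  proof (rule recfn_cong[OF recfn_prec])
    show "recfn X (Suc 0) (\<lambda>xs. xs ! 0)" by (rule recfn_proj) simp
    show "recfn X (Suc (Suc (Suc 0))) (\<lambda>xs. xs ! 1 - 1)" by (intro pred recfn_proj) simp
    fix xs :: "nat list" assume "length xs = Suc (Suc 0)"
    then obtain a b where [simp]: "xs = [a, b]" by (auto simp: length_Suc_conv)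
    show "rec_nat (tl xs ! 0) (\<lambda>n y. (n # y # tl xs) ! 1 - 1) (hd xs) = xs ! 1 - xs ! 0"
      by (simp, induction a) auto
  qed
  from recfn_comp2[OF this g f] show ?thesis by simp
qed

lemma recfn_triangle: "recfn X k g \<Longrightarrow> recfn X k (\<lambda>xs. triangle (g xs))"
proof -
  assume g: "recfn X k g"
  have "recfn X (Suc 0) (\<lambda>xs. triangle (xs ! 0))"
  proof (rule recfn_cong[OF recfn_prec])
    show "recfn X 0 (\<lambda>xs. 0)" by (rule recfn_zero)
    show "recfn X (Suc (Suc 0)) (\<lambda>xs. xs ! 1 + Suc (xs ! 0))"
      by (intro recfn_add recfn_Suc recfn_proj) simp_all
    fix xs :: "nat list" assume "length xs = Suc 0"
    then obtain a where [simp]: "xs = [a]" by (auto simp: length_Suc_conv)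
    show "rec_nat 0 (\<lambda>n y. (n # y # tl xs) ! 1 + Suc ((n # y # tl xs) ! 0)) (hd xs) = triangle (xs ! 0)"
      by (simp, induction a) auto
  qed
  from recfn_comp1[OF this g] show ?thesis by simp
qed

section \<open>Cantor pairing and its projections\<close>

definition pair :: "nat \<Rightarrow> nat \<Rightarrow> nat" where "pair a b = prod_encode (a, b)"
definition pfst :: "nat \<Rightarrow> nat" where "pfst n = fst (prod_decode n)"
definition psnd :: "nat \<Rightarrow> nat" where "psnd n = snd (prod_decode n)"

lemma pfst_pair [simp]: "pfst (pair a b) = a"
  and psnd_pair [simp]: "psnd (pair a b) = b"
  and pair_collapse [simp]: "pair (pfst n) (psnd n) = n"
  and pair_inject [simp]: "pair a b = pair c d \<longleftrightarrow> a = c \<and> b = d"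
  by (auto simp: pair_def pfst_def psnd_def)

lemma le_pair: "a \<le> pair a b" "b \<le> pair a b"
  by (auto simp: pair_def le_prod_encode_1 le_prod_encode_2)

lemma recfn_pair: "recfn X k f \<Longrightarrow> recfn X k g \<Longrightarrow> recfn X k (\<lambda>xs. pair (f xs) (g xs))"
  unfolding pair_def prod_encode_def by (simp add: recfn_add recfn_triangle)

text \<open>The diagonal of the Cantor pairing on which n lies, that is, the least k with
  \<open>n < triangle (Suc k)\<close>. It is phrased as a vanishing difference because
  \<open>recfn_mu\<close> searches for a zero.\<close>

definition psum :: "nat \<Rightarrow> nat" where "psum n = (LEAST k. Suc n - triangle (Suc k) = 0)"

lemma psum_eq: "psum n = pfst n + psnd n"
proof -
  define a b where "a = pfst n" and "b = psnd n"
  have n: "n = triangle (a + b) + a"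
    using pair_collapse[of n] by (simp add: a_def b_def pair_def prod_encode_def)
  have mono: "triangle i \<le> triangle j" if "i \<le> j" for i j
    using that by (induction j) (auto simp: le_Suc_eq)
  show ?thesis
    unfolding psum_def a_def[symmetric] b_def[symmetric]
  proof (rule Least_equality)
    show "Suc n - triangle (Suc (a + b)) = 0" by (simp add: n)
    fix k assume k: "Suc n - triangle (Suc k) = 0"
    show "a + b \<le> k"
    proof (rule ccontr)
      assume "\<not> a + b \<le> k"
      then have "triangle (Suc k) \<le> triangle (a + b)" by (intro mono) simp
      with k n show False by simp
    qed
  qed
qed

lemma recfn_psum: "recfn X k g \<Longrightarrow> recfn X k (\<lambda>xs. psum (g xs))"
proof -
  assume g: "recfn X k g"
  have "recfn X (Suc 0) (\<lambda>xs. LEAST k. (\<lambda>ys. Suc (ys ! 1) - triangle (Suc (ys ! 0))) (k # xs) = 0)"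
  proof (rule recfn_mu)
    show "recfn X (Suc (Suc 0)) (\<lambda>ys. Suc (ys ! 1) - triangle (Suc (ys ! 0)))"
      by (intro recfn_diff recfn_Suc recfn_triangle recfn_proj) simp_all
    fix xs :: "nat list" assume "length xs = Suc 0"
    then obtain a where [simp]: "xs = [a]" by (auto simp: length_Suc_conv)
    show "\<exists>n. Suc ((n # xs) ! 1) - triangle (Suc ((n # xs) ! 0)) = 0"
      by (rule exI[of _ a]) (simp add: triangle_Suc)
  qed
  from recfn_comp1[OF this g] show ?thesis by (simp add: psum_def)
qed

lemma pfst_eq: "pfst n = n - triangle (psum n)"
proof -
  have "n = triangle (pfst n + psnd n) + pfst n"
    using pair_collapse[of n] by (simp add: pair_def prod_encode_def)
  then show ?thesis by (simp add: psum_eq)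
qed

lemma recfn_pfst: "recfn X k g \<Longrightarrow> recfn X k (\<lambda>xs. pfst (g xs))"
  unfolding pfst_eq by (intro recfn_diff recfn_triangle recfn_psum)

lemma recfn_psnd: "recfn X k g \<Longrightarrow> recfn X k (\<lambda>xs. psnd (g xs))"
proof -
  assume "recfn X k g"
  then have "recfn X k (\<lambda>xs. psum (g xs) - pfst (g xs))"
    by (intro recfn_diff recfn_psum recfn_pfst)
  then show ?thesis by (simp add: psum_eq)
qed

text \<open>From here on all functions are unary: a bound variable enters the context by pairing, and
  the introduction rules below decompose a term by higher-order unification.\<close>

definition cpt :: "nat set \<Rightarrow> (nat \<Rightarrow> nat) \<Rightarrow> bool" where
  "cpt X f \<longleftrightarrow> (\<exists>t. \<forall>n. eval X t [n] (f n))"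

lemma cpt_recfn: "cpt X f \<longleftrightarrow> recfn X (Suc 0) (\<lambda>xs. f (xs ! 0))"
proof
  assume "cpt X f"
  then obtain t where t: "\<And>n. eval X t [n] (f n)" unfolding cpt_def by blast
  show "recfn X (Suc 0) (\<lambda>xs. f (xs ! 0))"
    unfolding recfn_def by (rule exI[of _ t]) (auto simp: length_Suc_conv t)
next
  assume "recfn X (Suc 0) (\<lambda>xs. f (xs ! 0))"
  then obtain t where t: "\<And>xs. length xs = Suc 0 \<Longrightarrow> eval X t xs (f (xs ! 0))"
    unfolding recfn_def by blast
  have "eval X t [n] (f n)" for n using t[of "[n]"] by simp
  then show "cpt X f" unfolding cpt_def by blast
qed

lemma recfn_cpt: "cpt X f \<Longrightarrow> recfn X k g \<Longrightarrow> recfn X k (\<lambda>xs. f (g xs))"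
  using recfn_comp1[of X "\<lambda>xs. f (xs ! 0)" k g] by (simp add: cpt_recfn)

lemma cpt_id: "cpt X (\<lambda>n. n)"
  unfolding cpt_recfn by (rule recfn_proj) simp

lemma cpt_comp: "cpt X f \<Longrightarrow> cpt X g \<Longrightarrow> cpt X (\<lambda>n. f (g n))"
  unfolding cpt_recfn[of _ g] cpt_recfn[of _ "\<lambda>n. f (g n)"] by (rule recfn_cpt)

lemma cpt_Suc: "cpt X f \<Longrightarrow> cpt X (\<lambda>n. Suc (f n))"
  unfolding cpt_recfn by (rule recfn_Suc)

lemma cpt_const: "cpt X (\<lambda>n. c)"
proof (induction c)
  case 0 show ?case unfolding cpt_recfn by (rule recfn_zero)
qed (rule cpt_Suc)

lemma cpt_add: "cpt X f \<Longrightarrow> cpt X g \<Longrightarrow> cpt X (\<lambda>n. f n + g n)"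
  unfolding cpt_recfn by (rule recfn_add)

lemma cpt_diff: "cpt X f \<Longrightarrow> cpt X g \<Longrightarrow> cpt X (\<lambda>n. f n - g n)"
  unfolding cpt_recfn by (rule recfn_diff)

lemma cpt_pair: "cpt X f \<Longrightarrow> cpt X g \<Longrightarrow> cpt X (\<lambda>n. pair (f n) (g n))"
  unfolding cpt_recfn by (rule recfn_pair)

lemma cpt_pfst: "cpt X f \<Longrightarrow> cpt X (\<lambda>n. pfst (f n))"
  unfolding cpt_recfn by (rule recfn_pfst)

lemma cpt_psnd: "cpt X f \<Longrightarrow> cpt X (\<lambda>n. psnd (f n))"
  unfolding cpt_recfn by (rule recfn_psnd)

lemma cpt_rec:
  assumes f: "cpt X f" and h: "cpt X (\<lambda>p. h (pfst p) (pfst (psnd p)) (psnd (psnd p)))" and b: "cpt X b"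
  shows "cpt X (\<lambda>n. rec_nat (f n) (\<lambda>i y. h n i y) (b n))"
proof -
  \<comment> \<open>\<open>recfn_prec\<close> passes counter and accumulator first and the parameter
    last, whereas h expects the parameter first; the pairing rotates them.\<close>
  have "recfn X (Suc (Suc (Suc 0))) (\<lambda>xs. pair (xs ! 2) (pair (xs ! 0) (xs ! 1)))"
    by (intro recfn_pair recfn_proj) simp_all
  from recfn_cpt[OF h this]
  have h': "recfn X (Suc (Suc (Suc 0))) (\<lambda>xs. h (xs ! 2) (xs ! 0) (xs ! 1))" by simp
  have b': "recfn X (Suc 0) (\<lambda>xs. b (xs ! 0))" using b by (simp add: cpt_recfn)
  have i': "recfn X (Suc 0) (\<lambda>xs. xs ! 0)" by (rule recfn_proj) simp
  have f': "recfn X (Suc 0) (\<lambda>xs. f (xs ! 0))" using f by (simp add: cpt_recfn)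
  from recfn_comp2[OF recfn_prec[OF f' h'] b' i'] show ?thesis
    by (simp add: cpt_recfn)
qed

lemma cpt_mult:
  assumes "cpt X f" "cpt X g" shows "cpt X (\<lambda>n. f n * g n)"
proof -
  have "cpt X (\<lambda>n. rec_nat 0 (\<lambda>i y. y + g n) (f n))"
    by (rule cpt_rec) (intro cpt_const cpt_add cpt_psnd cpt_id cpt_comp[OF assms(2)] cpt_pfst assms)+
  moreover have "rec_nat 0 (\<lambda>i y. y + b) a = a * b" for a b :: nat
    by (induction a) auto
  ultimately show ?thesis by simp
qed

section \<open>Decidable predicates and search\<close>

definition dec :: "nat set \<Rightarrow> (nat \<Rightarrow> bool) \<Rightarrow> bool" where
  "dec X P \<longleftrightarrow> cpt X (\<lambda>n. if P n then 1 else 0)"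

lemma turing_le_dec: "turing_le A X \<longleftrightarrow> dec X (\<lambda>n. n \<in> A)"
  by (simp add: turing_le_def dec_def cpt_def)

lemma dec_oracle: "dec X (\<lambda>n. n \<in> X)"
  unfolding dec_def cpt_recfn by (intro recfn_oracle recfn_proj) simp

lemma dec_subst: "dec X P \<Longrightarrow> cpt X f \<Longrightarrow> dec X (\<lambda>n. P (f n))"
  unfolding dec_def by (rule cpt_comp)

lemma dec_not: "dec X P \<Longrightarrow> dec X (\<lambda>n. \<not> P n)"
proof -
  assume "dec X P"
  then have "cpt X (\<lambda>n. 1 - (if P n then 1 else 0))"
    unfolding dec_def by (intro cpt_diff cpt_const)
  moreover have "(\<lambda>n. 1 - (if P n then 1 else 0)) = (\<lambda>n. if \<not> P n then 1 else (0::nat))" by auto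
  ultimately show ?thesis unfolding dec_def by simp
qed

lemma dec_conj: "dec X P \<Longrightarrow> dec X Q \<Longrightarrow> dec X (\<lambda>n. P n \<and> Q n)"
proof -
  assume "dec X P" "dec X Q"
  then have "cpt X (\<lambda>n. (if P n then 1 else 0) * (if Q n then 1 else 0))"
    unfolding dec_def by (rule cpt_mult)
  moreover have "(\<lambda>n. (if P n then 1 else 0) * (if Q n then 1 else 0))
      = (\<lambda>n. if P n \<and> Q n then 1 else (0::nat))" by auto
  ultimately show ?thesis unfolding dec_def by simp
qed

lemma dec_disj: "dec X P \<Longrightarrow> dec X Q \<Longrightarrow> dec X (\<lambda>n. P n \<or> Q n)"
  using dec_not[OF dec_conj[OF dec_not[of X P] dec_not[of X Q]]] by simp

lemma dec_le: "cpt X f \<Longrightarrow> cpt X g \<Longrightarrow> dec X (\<lambda>n. f n \<le> g n)"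
proof -
  assume "cpt X f" "cpt X g"
  then have "cpt X (\<lambda>n. 1 - (f n - g n))" by (intro cpt_diff cpt_const)
  moreover have "(\<lambda>n. 1 - (f n - g n)) = (\<lambda>n. if f n \<le> g n then 1 else 0)" by auto
  ultimately show ?thesis unfolding dec_def by simp
qed

lemma dec_less: "cpt X f \<Longrightarrow> cpt X g \<Longrightarrow> dec X (\<lambda>n. f n < g n)"
  using dec_le[OF cpt_Suc[of X f], of g] by (simp add: Suc_le_eq)

lemma dec_eq: "cpt X f \<Longrightarrow> cpt X g \<Longrightarrow> dec X (\<lambda>n. f n = g n)"
  using dec_conj[OF dec_le[of X f g] dec_le[of X g f]] by (simp add: order_eq_iff)

lemma cpt_if: "dec X P \<Longrightarrow> cpt X f \<Longrightarrow> cpt X g \<Longrightarrow> cpt X (\<lambda>n. if P n then f n else g n)"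
proof -
  assume "dec X P" "cpt X f" "cpt X g"
  then have "cpt X (\<lambda>n. (if P n then 1 else 0) * f n + (if \<not> P n then 1 else 0) * g n)"
    using dec_not[of X P] unfolding dec_def by (intro cpt_add cpt_mult)
  moreover have "(\<lambda>n. (if P n then 1 else 0) * f n + (if \<not> P n then 1 else 0) * g n)
      = (\<lambda>n. if P n then f n else g n)" by auto
  ultimately show ?thesis by simp
qed

lemma dec_bex:
  assumes "dec X (\<lambda>p. Q (pfst p) (psnd p))" "cpt X b"
  shows "dec X (\<lambda>n. \<exists>i<b n. Q n i)"
proof -
  have "cpt X (\<lambda>n. rec_nat 0 (\<lambda>i y. if Q n i then 1 else y) (b n))"
  proof (rule cpt_rec[OF cpt_const _ assms(2)])
    have "dec X (\<lambda>p. Q (pfst (pair (pfst p) (pfst (psnd p)))) (psnd (pair (pfst p) (pfst (psnd p)))))"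
      by (rule dec_subst[OF assms(1)]) (intro cpt_pair cpt_pfst cpt_psnd cpt_id)
    then show "cpt X (\<lambda>p. if Q (pfst p) (pfst (psnd p)) then 1 else psnd (psnd p))"
      by (intro cpt_if cpt_const cpt_psnd cpt_id) simp
  qed
  moreover have "rec_nat 0 (\<lambda>i y. if R i then 1 else y) m = (if \<exists>i<m. R i then 1 else (0::nat))" for R m
    by (induction m) (auto simp: less_Suc_eq)
  ultimately show ?thesis unfolding dec_def by simp
qed

lemma dec_ball:
  assumes "dec X (\<lambda>p. Q (pfst p) (psnd p))" "cpt X b"
  shows "dec X (\<lambda>n. \<forall>i<b n. Q n i)"
  using dec_not[OF dec_bex[OF dec_not[OF assms(1)] assms(2)]] by simp

lemma if_one_zero_eq_0: "((if b then 1 else 0) = (0::nat)) \<longleftrightarrow> \<not> b"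
  by simp

lemma cpt_Least:
  assumes "dec X (\<lambda>p. Q (pfst p) (psnd p))" "\<And>n. \<exists>k. Q n k"
  shows "cpt X (\<lambda>n. LEAST k. Q n k)"
proof -
  \<comment> \<open>The search stops at a zero, hence the characteristic function of the
    negation.\<close>
  have "cpt X (\<lambda>p. if \<not> Q (pfst p) (psnd p) then 1 else 0)"
    using dec_not[OF assms(1)] unfolding dec_def .
  from recfn_cpt[OF this, of "Suc (Suc 0)" "\<lambda>xs. pair (xs ! 1) (xs ! 0)"]
  have "recfn X (Suc (Suc 0)) (\<lambda>xs. if \<not> Q (xs ! 1) (xs ! 0) then 1 else 0)"
    by (simp add: recfn_pair recfn_proj)
  from recfn_mu[OF this]
  have "recfn X (Suc 0) (\<lambda>xs. LEAST n. (if \<not> Q (xs ! 0) n then 1 else 0) = (0::nat))"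
    using assms(2) by simp
  then show ?thesis unfolding cpt_recfn by (simp only: if_one_zero_eq_0 not_not)
qed

section \<open>Coded finite lists\<close>

definition ltl :: "nat \<Rightarrow> nat" where "ltl m = psnd (m - 1)"
definition lhd :: "nat \<Rightarrow> nat" where "lhd m = pfst (m - 1)"
definition ldrop :: "nat \<Rightarrow> nat \<Rightarrow> nat" where "ldrop m i = rec_nat m (\<lambda>_. ltl) i"
definition lnth :: "nat \<Rightarrow> nat \<Rightarrow> nat" where "lnth m i = lhd (ldrop m i)"
definition llen :: "nat \<Rightarrow> nat" where "llen m = (LEAST i. ldrop m i = 0)"

text \<open>Makes 0, the code of the empty list, its own tail, so that dropping beyond the end of a
  list stays at 0.\<close>

lemma psnd_0 [simp]: "psnd 0 = 0"
  using le_pair(2)[where a = "pfst 0" and b = "psnd 0"] by (simp only: pair_collapse)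

lemma list_encode_Cons: "list_encode (x # xs) = Suc (pair x (list_encode xs))"
  by (simp add: pair_def)

lemma ltl_list_encode: "ltl (list_encode xs) = list_encode (tl xs)"
  by (cases xs) (simp_all add: ltl_def list_encode_Cons del: list_encode.simps(2))

lemma ldrop_list_encode: "ldrop (list_encode xs) i = list_encode (drop i xs)"
  unfolding ldrop_def by (induction i) (auto simp: ltl_list_encode drop_Suc tl_drop)

lemma list_encode_eq_0: "list_encode xs = 0 \<longleftrightarrow> xs = []"
  by (cases xs) auto

lemma llen_list_encode [simp]: "llen (list_encode xs) = length xs"
  unfolding llen_def ldrop_list_encode list_encode_eq_0 by (rule Least_equality) auto

lemma lnth_list_encode [simp]: "i < length xs \<Longrightarrow> lnth (list_encode xs) i = xs ! i"
  by (auto simp: lnth_def ldrop_list_encode lhd_def list_encode_Cons Cons_nth_drop_Suc[symmetric]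
      simp del: list_encode.simps(2))

lemma ldrop_Least_ex: "\<exists>i. ldrop m i = 0"
proof -
  have "m = list_encode (list_decode m)" by simp
  then show ?thesis by (metis ldrop_list_encode drop_all list_encode.simps(1) order_refl)
qed

lemma cpt_ltl: "cpt X f \<Longrightarrow> cpt X (\<lambda>n. ltl (f n))"
  unfolding ltl_def by (intro cpt_psnd cpt_diff cpt_const)

lemma cpt_lhd: "cpt X f \<Longrightarrow> cpt X (\<lambda>n. lhd (f n))"
  unfolding lhd_def by (intro cpt_pfst cpt_diff cpt_const)

lemma cpt_ldrop: "cpt X f \<Longrightarrow> cpt X g \<Longrightarrow> cpt X (\<lambda>n. ldrop (f n) (g n))"
  unfolding ldrop_def by (intro cpt_rec cpt_ltl cpt_psnd cpt_id)

lemma cpt_lnth: "cpt X f \<Longrightarrow> cpt X g \<Longrightarrow> cpt X (\<lambda>n. lnth (f n) (g n))"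
  unfolding lnth_def by (intro cpt_lhd cpt_ldrop)

lemma cpt_llen: "cpt X f \<Longrightarrow> cpt X (\<lambda>n. llen (f n))"
  unfolding llen_def
  by (rule cpt_Least[OF _ ldrop_Least_ex], intro dec_eq cpt_ldrop cpt_psnd cpt_id cpt_const)
    (rule cpt_comp[of X f pfst], assumption, intro cpt_pfst cpt_id)

text \<open>Replaces a choice function on an initial segment by a number, so that quantifiers over
  finite tuples become quantifiers over numbers.\<close>

lemma ex_lnth: "\<exists>M. \<forall>i<b. lnth M i = g i"
  by (rule exI[of _ "list_encode (map g [0..<b])"]) simp

section \<open>Finite sets coded by binary expansions\<close>

lemma cpt_power2: "cpt X f \<Longrightarrow> cpt X (\<lambda>n. 2 ^ f n)"
proof -
  assume f: "cpt X f"
  have "cpt X (\<lambda>n. rec_nat 1 (\<lambda>i y. 2 * y) (f n))"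
    by (intro cpt_rec cpt_mult cpt_const cpt_psnd cpt_id f)
  moreover have "rec_nat 1 (\<lambda>i y. 2 * y) m = (2::nat) ^ m" for m
    by (induction m) auto
  ultimately show ?thesis by simp
qed

text \<open>Describes bit x of D without division: r is the part below the bit and q the part above
  it, and both range over bounded sets, so membership becomes decidable by bounded search.\<close>

lemma mem_set_decode_iff:
  "x \<in> set_decode D \<longleftrightarrow> (\<exists>q<Suc D. \<exists>r<2 ^ x. D = (2 * q + 1) * 2 ^ x + r)"
proof
  assume "x \<in> set_decode D"
  then have o: "odd (D div 2 ^ x)" by (simp add: set_decode_def)
  then obtain q where q: "D div 2 ^ x = 2 * q + 1" by (rule oddE)
  have "D = (2 * q + 1) * 2 ^ x + D mod 2 ^ x" using q by (metis div_mult_mod_eq)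
  moreover have "q < Suc D"
  proof -
    have "2 * q + 1 \<le> D" using q by (metis div_le_dividend)
    then show ?thesis by simp
  qed
  moreover have "D mod 2 ^ x < 2 ^ x" by simp
  ultimately show "\<exists>q<Suc D. \<exists>r<2 ^ x. D = (2 * q + 1) * 2 ^ x + r" by blast
next
  assume "\<exists>q<Suc D. \<exists>r<2 ^ x. D = (2 * q + 1) * 2 ^ x + r"
  then obtain q r where "r < 2 ^ x" and D: "D = (2 * q + 1) * 2 ^ x + r" by blast
  then have "D div 2 ^ x = (r + (2 * q + 1) * 2 ^ x) div 2 ^ x" by (simp only: add.commute)
  also have "\<dots> = 2 * q + 1 + r div 2 ^ x" by (rule div_mult_self1) simp
  finally have "D div 2 ^ x = 2 * q + 1" using \<open>r < 2 ^ x\<close> by simp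
  then show "x \<in> set_decode D" by (simp add: set_decode_def)
qed

text \<open>Turns quantification over a coded finite set into bounded quantification, which does not
  raise the level in the hierarchy.\<close>

lemma mem_set_decode_less: "x \<in> set_decode D \<Longrightarrow> x < D"
proof -
  assume "x \<in> set_decode D"
  then have "D div 2 ^ x \<noteq> 0" by (metis even_zero mem_Collect_eq set_decode_def)
  then have "2 ^ x \<le> D" by (simp add: div_eq_0_iff)
  moreover have "x < 2 ^ x" by simp
  ultimately show ?thesis by linarith
qed

lemma dec_set_decode:
  assumes "cpt X f" "cpt X g" shows "dec X (\<lambda>n. f n \<in> set_decode (g n))"
proof -
  have "dec X (\<lambda>n. pfst n \<in> set_decode (psnd n))"
    unfolding mem_set_decode_iff
    by (intro dec_bex dec_eq cpt_add cpt_mult cpt_const cpt_power2 cpt_pfst cpt_psnd cpt_id cpt_Suc)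
  from dec_subst[OF this cpt_pair[OF assms]] show ?thesis by simp
qed

section \<open>The arithmetical hierarchy relative to an oracle\<close>

text \<open>Only the Sigma classes are named; a predicate is Pi_k if its negation is
  \<open>sigma X k\<close>. The negation in the successor case produces the alternation of
  quantifiers.\<close>

fun sigma :: "nat set \<Rightarrow> nat \<Rightarrow> (nat \<Rightarrow> bool) \<Rightarrow> bool" where
  "sigma X 0 P \<longleftrightarrow> dec X P"
| "sigma X (Suc k) P \<longleftrightarrow> (\<exists>Q. sigma X k Q \<and> (\<forall>n. P n \<longleftrightarrow> (\<exists>m. \<not> Q (pair n m))))"

lemma sigma_SucI:
  "sigma X k (\<lambda>p. Q (pfst p) (psnd p)) \<Longrightarrow> (\<And>n. P n \<longleftrightarrow> (\<exists>m. \<not> Q n m)) \<Longrightarrow> sigma X (Suc k) P"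
  by (auto intro!: exI[of _ "\<lambda>p. Q (pfst p) (psnd p)"])

lemma sigma_SucE:
  assumes "sigma X (Suc k) P"
  shows "\<exists>Q. sigma X k (\<lambda>p. Q (pfst p) (psnd p)) \<and> (\<forall>n. P n \<longleftrightarrow> (\<exists>m. \<not> Q n m))"
proof -
  from assms obtain Q where "sigma X k Q" "\<And>n. P n \<longleftrightarrow> (\<exists>m. \<not> Q (pair n m))" by auto
  then show ?thesis by (intro exI[of _ "\<lambda>n m. Q (pair n m)"]) simp
qed

lemma sigma_subst: "sigma X k P \<Longrightarrow> cpt X f \<Longrightarrow> sigma X k (\<lambda>n. P (f n))"
proof (induction k arbitrary: P f)
  case 0
  then show ?case by (simp add: dec_subst)
next
  case (Suc k)
  from sigma_SucE[OF Suc.prems(1)] obtain Q where Q: "sigma X k (\<lambda>p. Q (pfst p) (psnd p))" "\<And>n. P n \<longleftrightarrow> (\<exists>m. \<not> Q n m)"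
    by blast
  have "cpt X (\<lambda>p. pair (f (pfst p)) (psnd p))"
    by (intro cpt_pair cpt_psnd cpt_id cpt_comp[OF Suc.prems(2)] cpt_pfst)
  from Suc.IH[OF Q(1) this] show ?case
    by (intro sigma_SucI[where Q = "\<lambda>n. Q (f n)"]) (simp_all add: Q(2))
qed

text \<open>A dummy existential quantifier puts Pi_k into Sigma_(k+1).\<close>

lemma sigma_swap_not: "sigma X k P \<Longrightarrow> sigma X (Suc k) (\<lambda>n. \<not> P n)"
  by (rule sigma_SucI[where Q = "\<lambda>n m. P n"], erule sigma_subst) (auto intro: cpt_pfst cpt_id)

lemma sigma_dec: "dec X P \<Longrightarrow> sigma X k P"
proof (induction k arbitrary: P)
  case (Suc k)
  show ?case using sigma_swap_not[OF Suc.IH[OF dec_not[OF Suc.prems]]] by simp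
qed simp

text \<open>The additional quantifier is inserted innermost, at level 0, where predicates are closed
  under complement; the outer quantifiers are kept.\<close>

lemma sigma_mono: "sigma X k P \<Longrightarrow> sigma X (Suc k) P"
proof (induction k arbitrary: P)
  case 0
  then show ?case using sigma_dec by (simp del: sigma.simps(2))
next
  case (Suc k)
  from sigma_SucE[OF Suc.prems(1)] obtain Q where Q: "sigma X k (\<lambda>p. Q (pfst p) (psnd p))" "\<And>n. P n \<longleftrightarrow> (\<exists>m. \<not> Q n m)"
    by blast
  from sigma_SucI[OF Suc.IH[OF Q(1)] Q(2)] show ?case .
qed

text \<open>Both closures are proved together because the negated matrix exchanges them. A
  conjunction needs a pair of witnesses, a disjunction can use one witness for both sides.\<close>

lemma sigma_conj_disj:
  "sigma X k P \<Longrightarrow> sigma X k Q \<Longrightarrow> sigma X k (\<lambda>n. P n \<and> Q n) \<and> sigma X k (\<lambda>n. P n \<or> Q n)"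
proof (induction k arbitrary: P Q)
  case 0
  then show ?case by (simp add: dec_conj dec_disj)
next
  case (Suc k)
  from sigma_SucE[OF Suc.prems(1)] obtain P' where P': "sigma X k (\<lambda>p. P' (pfst p) (psnd p))" "\<And>n. P n \<longleftrightarrow> (\<exists>m. \<not> P' n m)"
    by blast
  from sigma_SucE[OF Suc.prems(2)] obtain Q' where Q': "sigma X k (\<lambda>p. Q' (pfst p) (psnd p))" "\<And>n. Q n \<longleftrightarrow> (\<exists>m. \<not> Q' n m)"
    by blast
  have "sigma X k (\<lambda>p. P' (pfst p) (pfst (psnd p)))"
    using sigma_subst[OF P'(1), of "\<lambda>p. pair (pfst p) (pfst (psnd p))"]
    by (simp add: cpt_pair cpt_pfst cpt_psnd cpt_id)
  moreover have "sigma X k (\<lambda>p. Q' (pfst p) (psnd (psnd p)))"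
    using sigma_subst[OF Q'(1), of "\<lambda>p. pair (pfst p) (psnd (psnd p))"]
    by (simp add: cpt_pair cpt_pfst cpt_psnd cpt_id)
  ultimately have "sigma X k (\<lambda>p. P' (pfst p) (pfst (psnd p)) \<or> Q' (pfst p) (psnd (psnd p)))"
    using Suc.IH by blast
  then have 1: "sigma X (Suc k) (\<lambda>n. P n \<and> Q n)"
    by (rule sigma_SucI[where Q = "\<lambda>n m. P' n (pfst m) \<or> Q' n (psnd m)"])
      (metis P'(2) Q'(2) pfst_pair psnd_pair)
  have "sigma X k (\<lambda>p. P' (pfst p) (psnd p) \<and> Q' (pfst p) (psnd p))"
    using Suc.IH P' Q' by blast
  then have "sigma X (Suc k) (\<lambda>n. P n \<or> Q n)"
    by (rule sigma_SucI[where Q = "\<lambda>n m. P' n m \<and> Q' n m"]) (auto simp: P' Q')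
  with 1 show ?case by blast
qed

lemmas sigma_conj = sigma_conj_disj[THEN conjunct1]
lemmas sigma_disj = sigma_conj_disj[THEN conjunct2]

text \<open>Two adjacent existential quantifiers contract to one by pairing the witnesses.\<close>

lemma sigma_ex:
  assumes "sigma X (Suc k) (\<lambda>p. P (pfst p) (psnd p))"
  shows "sigma X (Suc k) (\<lambda>n. \<exists>m. P n m)"
proof -
  from sigma_SucE[OF assms] obtain Q where Q: "sigma X k (\<lambda>p. Q (pfst p) (psnd p))"
    "\<And>p. P (pfst p) (psnd p) \<longleftrightarrow> (\<exists>m. \<not> Q p m)"
    by blast
  have "sigma X k (\<lambda>p. Q (pair (pfst p) (pfst (psnd p))) (psnd (psnd p)))"
    using sigma_subst[OF Q(1), of "\<lambda>p. pair (pair (pfst p) (pfst (psnd p))) (psnd (psnd p))"]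
    by (simp add: cpt_pair cpt_pfst cpt_psnd cpt_id)
  then show ?thesis
  proof (rule sigma_SucI[where Q = "\<lambda>n m. Q (pair n (pfst m)) (psnd m)"])
    fix n
    have "(\<exists>m. P n m) \<longleftrightarrow> (\<exists>m l. \<not> Q (pair n m) l)"
      using Q(2)[of "pair n _"] by simp
    also have "\<dots> \<longleftrightarrow> (\<exists>m. \<not> Q (pair n (pfst m)) (psnd m))"
      by (metis pfst_pair psnd_pair)
    finally show "(\<exists>m. P n m) \<longleftrightarrow> (\<exists>m. \<not> Q (pair n (pfst m)) (psnd m))" .
  qed
qed

text \<open>A bounded universal quantifier moves past an unbounded existential one by collecting the
  finitely many witnesses in a coded list M. Under the negation it becomes a bounded existential
  quantifier of the matrix, hence the joint induction.\<close>

lemma sigma_ball_bex: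
  assumes "cpt X b"
  shows "sigma X k (\<lambda>p. P (pfst p) (psnd p)) \<Longrightarrow>
    sigma X k (\<lambda>n. \<forall>i<b n. P n i) \<and> sigma X k (\<lambda>n. \<exists>i<b n. P n i)"
  using assms
proof (induction k arbitrary: P b)
  case 0
  then show ?case by (simp add: dec_ball dec_bex)
next
  case (Suc k)
  from Suc.prems have "sigma X (Suc k) (\<lambda>p. psnd p < b (pfst p) \<and> P (pfst p) (psnd p))"
    by (intro sigma_conj[OF sigma_dec[OF dec_less]] cpt_psnd cpt_comp[OF Suc.prems(2)] cpt_pfst cpt_id)
  from sigma_ex[OF this]
  have bex: "sigma X (Suc k) (\<lambda>n. \<exists>i<b n. P n i)" .
  from sigma_SucE[OF Suc.prems(1)] obtain Q where Q: "sigma X k (\<lambda>p. Q (pfst p) (psnd p))"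
    "\<And>p. P (pfst p) (psnd p) \<longleftrightarrow> (\<exists>m. \<not> Q p m)"
    by blast
  have "sigma X k (\<lambda>p. Q (pair (pfst (pfst p)) (psnd p)) (lnth (psnd (pfst p)) (psnd p)))"
    using sigma_subst[OF Q(1), of "\<lambda>p. pair (pair (pfst (pfst p)) (psnd p)) (lnth (psnd (pfst p)) (psnd p))"]
    by (simp add: cpt_pair cpt_pfst cpt_psnd cpt_id cpt_lnth)
  from Suc.IH[OF this, of "\<lambda>p. b (pfst p)"] Suc.prems(2)
  have "sigma X k (\<lambda>p. \<exists>i<b (pfst p). Q (pair (pfst p) i) (lnth (psnd p) i))"
    by (simp add: cpt_comp[OF Suc.prems(2)] cpt_pfst cpt_id)
  then have "sigma X (Suc k) (\<lambda>n. \<forall>i<b n. P n i)"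
  proof (rule sigma_SucI[where Q = "\<lambda>n M. \<exists>i<b n. Q (pair n i) (lnth M i)"])
    fix n
    have "(\<forall>i<b n. P n i) \<longleftrightarrow> (\<forall>i<b n. \<exists>m. \<not> Q (pair n i) m)"
      using Q(2)[of "pair n _"] by simp
    also have "\<dots> \<longleftrightarrow> (\<exists>g. \<forall>i<b n. \<not> Q (pair n i) (g i))" by metis
    also have "\<dots> \<longleftrightarrow> (\<exists>M. \<forall>i<b n. \<not> Q (pair n i) (lnth M i))"
      using ex_lnth[of "b n"] by metis
    finally show "(\<forall>i<b n. P n i) \<longleftrightarrow> (\<exists>M. \<not> (\<exists>i<b n. Q (pair n i) (lnth M i)))" by blast
  qed
  with bex show ?case by blast
qed

lemma sigma_ball:
  "sigma X k (\<lambda>p. P (pfst p) (psnd p)) \<Longrightarrow> cpt X b \<Longrightarrow> sigma X k (\<lambda>n. \<forall>i<b n. P n i)"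
  using sigma_ball_bex by blast

lemma sigma_bex:
  "sigma X k (\<lambda>p. P (pfst p) (psnd p)) \<Longrightarrow> cpt X b \<Longrightarrow> sigma X k (\<lambda>n. \<exists>i<b n. P n i)"
  using sigma_ball_bex by blast

lemmas cpt_intros = cpt_pair cpt_pfst cpt_psnd cpt_id cpt_const cpt_Suc cpt_lnth cpt_llen
  cpt_lhd cpt_ltl cpt_ldrop cpt_add cpt_mult

section \<open>Evaluation as closure of finite sets of facts\<close>

text \<open>A fact \<open>code_fact c\<close> claims that \<open>c\<close> is the code of a term, \<open>eval_fact c xs y\<close> that this term evaluates to
  \<open>y\<close> on the coded arguments \<open>xs\<close>. A derivation is just a finite set in which each fact is justified
  by others, without any ordering: every rule decreases the term or the first argument, so circular
  justification is impossible.\<close>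

definition code_fact :: "nat \<Rightarrow> nat" where "code_fact c = pair 0 c"
definition eval_fact :: "nat \<Rightarrow> nat \<Rightarrow> nat \<Rightarrow> nat" where "eval_fact c xs y = pair 1 (pair c (pair xs y))"

definition code_step :: "nat set \<Rightarrow> nat \<Rightarrow> bool" where
  "code_step S c \<longleftrightarrow> c = pair 0 0 \<or> c = pair 1 0 \<or> (\<exists>i. c = pair 2 i) \<or> c = pair 3 0 \<or>
    (\<exists>f gs. c = pair 4 (pair f gs) \<and> code_fact f \<in> S \<and> (\<forall>i<llen gs. code_fact (lnth gs i) \<in> S)) \<or>
    (\<exists>f g. c = pair 5 (pair f g) \<and> code_fact f \<in> S \<and> code_fact g \<in> S) \<or>
    (\<exists>f. c = pair 6 f \<and> code_fact f \<in> S)"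

definition eval_step :: "nat set \<Rightarrow> nat set \<Rightarrow> nat \<Rightarrow> nat \<Rightarrow> nat \<Rightarrow> bool" where
  "eval_step Z S c xs y \<longleftrightarrow>
    c = pair 0 0 \<and> y = 0 \<or>
    c = pair 1 0 \<and> 0 < llen xs \<and> y = Suc (lnth xs 0) \<or>
    (\<exists>i. c = pair 2 i \<and> i < llen xs \<and> y = lnth xs i) \<or>
    c = pair 3 0 \<and> 0 < llen xs \<and> (lnth xs 0 \<in> Z \<and> y = 1 \<or> lnth xs 0 \<notin> Z \<and> y = 0) \<or>
    (\<exists>f gs ys. c = pair 4 (pair f gs) \<and> llen ys = llen gs \<and>
       (\<forall>i<llen gs. eval_fact (lnth gs i) xs (lnth ys i) \<in> S) \<and> eval_fact f ys y \<in> S) \<or>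
    (\<exists>f g r. c = pair 5 (pair f g) \<and> xs = Suc (pair 0 r) \<and> eval_fact f r y \<in> S) \<or>
    (\<exists>f g r n z. c = pair 5 (pair f g) \<and> xs = Suc (pair (Suc n) r) \<and> eval_fact c (Suc (pair n r)) z \<in> S \<and>
       eval_fact g (Suc (pair n (Suc (pair z r)))) y \<in> S) \<or>
    (\<exists>f. c = pair 6 f \<and> eval_fact f (Suc (pair y xs)) 0 \<in> S \<and>
       (\<forall>m<y. \<exists>k. eval_fact f (Suc (pair m xs)) (Suc k) \<in> S))"

definition justified :: "nat set \<Rightarrow> nat set \<Rightarrow> nat \<Rightarrow> bool" where
  "justified Z S e \<longleftrightarrow>
    (\<exists>c. e = code_fact c \<and> code_step S c) \<or> (\<exists>c xs y. e = eval_fact c xs y \<and> eval_step Z S c xs y)"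

definition closed_facts :: "nat set \<Rightarrow> nat set \<Rightarrow> bool" where
  "closed_facts Z S \<longleftrightarrow> (\<forall>e\<in>S. justified Z S e)"

text \<open>\<open>set_decode\<close> ranges over all finite sets, so a derivation is a number and
  derivability costs one existential quantifier.\<close>

definition derivable :: "nat set \<Rightarrow> nat \<Rightarrow> bool" where
  "derivable Z e \<longleftrightarrow> (\<exists>D. closed_facts Z (set_decode D) \<and> e \<in> set_decode D)"

lemma sigma_set_decode: "cpt X f \<Longrightarrow> cpt X g \<Longrightarrow> sigma X k (\<lambda>n. f n \<in> set_decode (g n))"
  by (rule sigma_dec[OF dec_set_decode])

lemma sigma_oracle: "sigma X k (\<lambda>n. n \<in> Z) \<Longrightarrow> cpt X f \<Longrightarrow> sigma X (Suc k) (\<lambda>n. f n \<in> Z)"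
  by (rule sigma_mono, rule sigma_subst[where P = "\<lambda>n. n \<in> Z"])

lemma sigma_not_oracle: "sigma X k (\<lambda>n. n \<in> Z) \<Longrightarrow> cpt X f \<Longrightarrow> sigma X (Suc k) (\<lambda>n. f n \<notin> Z)"
  by (rule sigma_swap_not, rule sigma_subst[where P = "\<lambda>n. n \<in> Z"])

lemma cpt_code_fact: "cpt X f \<Longrightarrow> cpt X (\<lambda>n. code_fact (f n))"
  unfolding code_fact_def by (intro cpt_intros)

lemma cpt_eval_fact: "cpt X f \<Longrightarrow> cpt X g \<Longrightarrow> cpt X h \<Longrightarrow> cpt X (\<lambda>n. eval_fact (f n) (g n) (h n))"
  unfolding eval_fact_def by (intro cpt_intros)

text \<open>The oracle is consulted positively and negatively, and both Z and its complement are
  available at level Suc k. All other conditions are decidable, and the only quantifiers around them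
  are bounded ones and existential ones, under which that level is closed.\<close>

lemma sigma_deriv:
  assumes "sigma X k (\<lambda>n. n \<in> Z)" "cpt X f"
  shows "sigma X (Suc k) (\<lambda>n. derivable Z (f n))"
proof -
  \<comment> \<open>As a disjunction, the implication contains only the negation of a decidable
    condition.\<close>
  have *: "closed_facts Z (set_decode D) \<longleftrightarrow> (\<forall>e<D. \<not> e \<in> set_decode D \<or> justified Z (set_decode D) e)" for D
    unfolding closed_facts_def by (meson mem_set_decode_less)
  have eq: "sigma X j (\<lambda>n. f n = g n)" if "cpt X f" "cpt X g" for f g j
    using that by (intro sigma_dec dec_eq)
  have less: "sigma X j (\<lambda>n. f n < g n)" if "cpt X f" "cpt X g" for f g j
    using that by (intro sigma_dec dec_less)
  have nmem: "sigma X j (\<lambda>n. \<not> f n \<in> set_decode (g n))" if "cpt X f" "cpt X g" for f g j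
    using that by (intro sigma_dec dec_not dec_set_decode)
  have c: "sigma X (Suc k) (\<lambda>n. code_step (set_decode (f n)) (g n))" if "cpt X f" "cpt X g" for f g
  proof -
    have "sigma X (Suc k) (\<lambda>n. code_step (set_decode (pfst n)) (psnd n))"
      unfolding code_step_def
      by (intro sigma_disj sigma_conj sigma_ex sigma_ball eq sigma_set_decode cpt_intros cpt_code_fact)
    from sigma_subst[OF this, of "\<lambda>n. pair (f n) (g n)"] that show ?thesis
      by (simp add: cpt_pair)
  qed
  have e: "sigma X (Suc k) (\<lambda>n. eval_step Z (set_decode (f n)) (g n) (h n) (i n))"
    if "cpt X f" "cpt X g" "cpt X h" "cpt X i" for f g h i
  proof -
    have "sigma X (Suc k) (\<lambda>n. eval_step Z (set_decode (pfst n)) (pfst (psnd n)) (pfst (psnd (psnd n))) (psnd (psnd (psnd n))))"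
      unfolding eval_step_def
      by (intro sigma_disj sigma_conj sigma_ex sigma_ball eq less sigma_set_decode sigma_oracle[OF assms(1)]
          sigma_not_oracle[OF assms(1)] cpt_intros cpt_eval_fact)
    from sigma_subst[OF this, of "\<lambda>n. pair (f n) (pair (g n) (pair (h n) (i n)))"] that show ?thesis
      by (simp add: cpt_pair)
  qed
  have "sigma X (Suc k) (\<lambda>n. derivable Z n)"
    unfolding derivable_def * justified_def
    by (intro sigma_ex sigma_conj sigma_disj sigma_ball eq nmem sigma_set_decode c e cpt_intros cpt_code_fact cpt_eval_fact)
  from sigma_subst[OF this assms(2)] show ?thesis .
qed

section \<open>Determinism of evaluation and injectivity of the term coding\<close>

inductive_cases eval_ZeroE: "eval X Zero xs y"
inductive_cases eval_SuccE: "eval X Succ xs y"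
inductive_cases eval_ProjE: "eval X (Proj i) xs y"
inductive_cases eval_OracleE: "eval X Oracle xs y"
inductive_cases eval_CompE: "eval X (Comp f gs) xs y"
inductive_cases eval_PrecE: "eval X (Prec f g) xs y"
inductive_cases eval_MuE: "eval X (Mu f) xs y"

lemma eval_det: "eval X t xs y \<Longrightarrow> eval X t xs z \<Longrightarrow> y = z"
proof (induction arbitrary: z rule: eval.induct)
  case (ev_zero xs)
  then show ?case by (auto elim: eval_ZeroE)
next
  case (ev_succ x xs)
  then show ?case by (auto elim: eval_SuccE)
next
  case (ev_proj i xs)
  then show ?case by (auto elim: eval_ProjE)
next
  case (ev_oracle x xs)
  then show ?case by (auto elim: eval_OracleE)
next
  case (ev_comp ys gs xs f w)
  from ev_comp.prems obtain zs where zs: "length zs = length gs"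
    "\<forall>i<length gs. eval X (gs ! i) xs (zs ! i)" "eval X f zs z"
    by (rule eval_CompE)
  have "ys = zs" using ev_comp.IH(1) ev_comp.hyps zs by (intro nth_equalityI) auto
  with ev_comp.IH zs show ?case by simp
next
  case (ev_prec0 f xs y g)
  from ev_prec0.prems show ?case by (rule eval_PrecE) (auto intro: ev_prec0.IH)
next
  case (ev_precS f g n xs y w)
  from ev_precS.prems obtain y' where "eval X (Prec f g) (n # xs) y'" "eval X g (n # y' # xs) z"
    by (rule eval_PrecE) auto
  with ev_precS.IH show ?case by blast
next
  case (ev_mu f n xs)
  from ev_mu.prems have z: "eval X f (z # xs) 0" "\<forall>m<z. \<exists>k. eval X f (m # xs) (Suc k)"
    by (auto elim: eval_MuE)
  have "\<not> n < z" using ev_mu.IH(1) z(2) by fastforce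
  moreover have "\<not> z < n" using ev_mu.IH(2) z(1) by fastforce
  ultimately show ?case by simp
qed

lemma eval_fact_inject [simp]: "eval_fact c x y = eval_fact c' x' y' \<longleftrightarrow> c = c' \<and> x = x' \<and> y = y'"
  and code_fact_inject [simp]: "code_fact c = code_fact c' \<longleftrightarrow> c = c'"
  and code_fact_neq_eval_fact [simp]: "code_fact c \<noteq> eval_fact c' x' y'" "eval_fact c' x' y' \<noteq> code_fact c"
  by (auto simp: eval_fact_def code_fact_def)

lemma code_pair:
  "code Zero = pair 0 0" "code Succ = pair 1 0" "code (Proj i) = pair 2 i" "code Oracle = pair 3 0"
  "code (Comp f gs) = pair 4 (pair (code f) (list_encode (map code gs)))"
  "code (Prec f g) = pair 5 (pair (code f) (code g))" "code (Mu f) = pair 6 (code f)"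
  by (simp_all add: pair_def)

lemma list_encode_eq_Suc_pair:
  "list_encode xs = Suc (pair a r) \<longleftrightarrow> (\<exists>ys. xs = a # ys \<and> r = list_encode ys)"
  by (cases xs) (auto simp: list_encode_Cons simp del: list_encode.simps(2))

text \<open>Needed to see which term a given number of the jump refers to: membership of
  \<open>code t\<close> concerns the halting of t itself.\<close>

lemma code_inject: "code s = code t \<Longrightarrow> s = t"
proof (induction s arbitrary: t)
  case (Comp f gs)
  then obtain f' gs' where t: "t = Comp f' gs'" by (cases t) (auto simp: code_pair simp del: code.simps)
  with Comp.prems have f: "code f = code f'" and g: "list_encode (map code gs) = list_encode (map code gs')"
    by (auto simp: code_pair simp del: code.simps)
  from g have "map code gs = map code gs'" by (simp add: list_encode_eq)
  then have "gs = gs'"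
    using Comp.IH(2) by (metis (no_types, lifting) length_map nth_equalityI nth_map nth_mem)
  with t f Comp.IH(1) show ?case by simp
next
  case Zero then show ?case by (cases t) (auto simp: code_pair simp del: code.simps)
next
  case Succ then show ?case by (cases t) (auto simp: code_pair simp del: code.simps)
next
  case (Proj i) then show ?case by (cases t) (auto simp: code_pair simp del: code.simps)
next
  case Oracle then show ?case by (cases t) (auto simp: code_pair simp del: code.simps)
next
  case (Prec f g)
  show ?case using Prec.prems Prec.IH by (cases t) (auto simp: code_pair simp del: code.simps)
next
  case (Mu f)
  show ?case using Mu.prems Mu.IH by (cases t) (auto simp: code_pair simp del: code.simps)
qed

section \<open>Soundness of derivations\<close>

lemma closed_eval_fact: "closed_facts Z S \<Longrightarrow> eval_fact c xs y \<in> S \<Longrightarrow> eval_step Z S c xs y"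
  unfolding closed_facts_def justified_def by fastforce

lemma closed_code_fact: "closed_facts Z S \<Longrightarrow> code_fact c \<in> S \<Longrightarrow> code_step S c"
  unfolding closed_facts_def justified_def by fastforce

text \<open>Induction on the term takes the place of an order on S. Primitive recursion refers back
  to the same term and so gets an inner induction on the recursion argument.\<close>

lemma closed_facts_eval:
  assumes S: "closed_facts Z S"
  shows "eval_fact (code t) (list_encode xs) y \<in> S \<Longrightarrow> eval Z t xs y"
proof (induction t arbitrary: xs y)
  case Zero
  from closed_eval_fact[OF S Zero] show ?case
    by (auto simp: eval_step_def code_pair simp del: code.simps intro: ev_zero)
next
  case Succ
  from closed_eval_fact[OF S Succ] obtain "0 < length xs" "y = Suc (lnth (list_encode xs) 0)"
    by (auto simp: eval_step_def code_pair simp del: code.simps)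
  then show ?case by (cases xs) (auto intro: ev_succ simp del: list_encode.simps)
next
  case (Proj i)
  from closed_eval_fact[OF S Proj] show ?case
    by (auto simp: eval_step_def code_pair simp del: code.simps intro: ev_proj)
next
  case Oracle
  from closed_eval_fact[OF S Oracle] obtain "0 < length xs" "y = (if lnth (list_encode xs) 0 \<in> Z then 1 else 0)"
    by (auto simp: eval_step_def code_pair simp del: code.simps)
  moreover from this obtain x r where "xs = x # r" by (cases xs) auto
  ultimately show ?case using ev_oracle[of Z x r] by (simp del: list_encode.simps)
next
  case (Comp f gs)
  from closed_eval_fact[OF S Comp.prems] obtain zs where z: "llen zs = length gs"
    "\<forall>i<length gs. eval_fact (code (gs ! i)) (list_encode xs) (lnth zs i) \<in> S" "eval_fact (code f) zs y \<in> S"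
    by (auto simp: eval_step_def code_pair simp del: code.simps)
  \<comment> \<open>Every number codes a list, so the recorded intermediate values can be read as
    one.\<close>
  define ys where "ys = list_decode zs"
  have zs: "zs = list_encode ys" by (simp add: ys_def)
  show ?case
    by (rule ev_comp[of ys]) (use z Comp.IH zs in auto)
next
  case (Prec f g)
  obtain n r where xs: "xs = n # r"
    using closed_eval_fact[OF S Prec.prems]
    by (auto simp: eval_step_def code_pair list_encode_eq_Suc_pair simp del: code.simps)
  show ?case
    using Prec.prems unfolding xs
  proof (induction n arbitrary: y)
    case 0
    from closed_eval_fact[OF S 0] have "eval_fact (code f) (list_encode r) y \<in> S"
      by (auto simp: eval_step_def code_pair list_encode_eq_Suc_pair simp del: code.simps list_encode.simps)
    then show ?case by (intro ev_prec0 Prec.IH)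
  next
    case (Suc n)
    from closed_eval_fact[OF S Suc.prems] obtain z where
      "eval_fact (code (Prec f g)) (list_encode (n # r)) z \<in> S" "eval_fact (code g) (list_encode (n # z # r)) y \<in> S"
      by (auto simp: eval_step_def code_pair list_encode_eq_Suc_pair list_encode_Cons
          simp del: code.simps list_encode.simps)
    then show ?case by (intro ev_precS[OF Suc.IH Prec.IH(2)])
  qed
next
  case (Mu f)
  from closed_eval_fact[OF S Mu.prems] have
    "eval_fact (code f) (list_encode (y # xs)) 0 \<in> S" "\<forall>m<y. \<exists>k. eval_fact (code f) (list_encode (m # xs)) (Suc k) \<in> S"
    by (auto simp: eval_step_def code_pair list_encode_eq_Suc_pair list_encode_Cons
        simp del: code.simps list_encode.simps)
  then show ?case by (intro ev_mu) (use Mu.IH in blast)+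
qed

text \<open>The tag must be positive, as \<open>pair 0 0\<close> is 0. The compound terms carry tags
  4 to 6, so the codes of their parts are strictly smaller, which drives the induction on
  codes.\<close>

lemma less_pair_Suc: "b < pair (Suc a) b"
proof -
  have "pair (Suc a) b = triangle (a + b) + Suc (a + b) + Suc a"
    by (simp add: pair_def prod_encode_def)
  then show ?thesis by linarith
qed

lemma nth_le_list_encode: "i < length xs \<Longrightarrow> xs ! i \<le> list_encode xs"
proof (induction xs arbitrary: i)
  case (Cons x xs)
  have "x \<le> list_encode (x # xs)" "list_encode xs \<le> list_encode (x # xs)"
    using le_pair[of x "list_encode xs"] le_pair[of "list_encode xs" x]
    by (auto simp: list_encode_Cons le_SucI simp del: list_encode.simps)
  with Cons show ?case by (cases i) (auto simp del: list_encode.simps intro: order_trans)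
qed simp

lemma closed_facts_code:
  assumes S: "closed_facts Z S"
  shows "code_fact c \<in> S \<Longrightarrow> \<exists>t. c = code t"
proof (induction c rule: less_induct)
  case (less c)
  from closed_code_fact[OF S less.prems] consider
      "c = pair 0 0" | "c = pair 1 0" | i where "c = pair 2 i" | "c = pair 3 0"
    | f gs where "c = pair 4 (pair f gs)" "code_fact f \<in> S" "\<forall>i<llen gs. code_fact (lnth gs i) \<in> S"
    | f g where "c = pair 5 (pair f g)" "code_fact f \<in> S" "code_fact g \<in> S"
    | f where "c = pair 6 f" "code_fact f \<in> S"
    unfolding code_step_def by blast
  then show ?case
  proof cases
    case (5 f gs)
    \<comment> \<open>The 3 is the predecessor of the tag 4 of a composition; the cases below use 4
      and 5 likewise.\<close>
    have lt: "pair f gs < c" using less_pair_Suc[of "pair f gs" 3] 5(1) by simp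
    then have "f < c" using le_pair(1)[of f gs] by simp
    then obtain s where s: "f = code s" using less.IH 5(2) by blast
    define ys where "ys = list_decode gs"
    have gs: "gs = list_encode ys" by (simp add: ys_def)
    have "\<exists>t. ys ! i = code t" if "i < length ys" for i
    proof (rule less.IH)
      show "ys ! i < c" using nth_le_list_encode[OF that] lt le_pair(2)[of gs f] gs by simp
      show "code_fact (ys ! i) \<in> S" using 5(3) gs that by auto
    qed
    then obtain h where h: "\<And>i. i < length ys \<Longrightarrow> ys ! i = code (h i)" by metis
    have "ys = map code (map h [0..<length ys])"
      by (rule nth_equalityI) (auto simp: h)
    then have "c = code (Comp s (map h [0..<length ys]))"
      using 5(1) s gs by (simp add: code_pair del: code.simps)
    then show ?thesis by blast
  next
    case (6 f g)
    have lt: "pair f g < c" using less_pair_Suc[of "pair f g" 4] 6(1) by simp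
    then have "f < c" "g < c" using le_pair(1)[of f g] le_pair(2)[of g f] by auto
    then obtain s t where "f = code s" "g = code t" using less.IH 6 by blast
    then show ?thesis using 6(1) code_pair(6) by metis
  next
    case (7 f)
    have "f < c" using less_pair_Suc[of f 5] 7(1) by simp
    then obtain s where "f = code s" using less.IH 7 by blast
    then show ?thesis using 7(1) code_pair(7) by metis
  qed (metis code_pair)+
qed

section \<open>Completeness of derivations\<close>

lemma derivable_finite: "derivable Z e \<longleftrightarrow> (\<exists>S. finite S \<and> closed_facts Z S \<and> e \<in> S)"
  unfolding derivable_def by (metis finite_set_decode set_encode_inverse)

lemma eval_step_mono: "eval_step Z S c xs y \<Longrightarrow> S \<subseteq> T \<Longrightarrow> eval_step Z T c xs y"
  unfolding eval_step_def by (elim disj_forward ex_forward conj_forward all_forward imp_forward) auto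

lemma code_step_mono: "code_step S c \<Longrightarrow> S \<subseteq> T \<Longrightarrow> code_step T c"
  unfolding code_step_def by (elim disj_forward ex_forward conj_forward all_forward imp_forward) auto

lemma justified_mono: "justified Z S e \<Longrightarrow> S \<subseteq> T \<Longrightarrow> justified Z T e"
  unfolding justified_def using code_step_mono eval_step_mono by blast

lemma closed_facts_Un: "closed_facts Z S \<Longrightarrow> closed_facts Z T \<Longrightarrow> closed_facts Z (S \<union> T)"
  unfolding closed_facts_def using justified_mono by blast

lemma derivable_facts_finite:
  assumes "finite F" "\<forall>e\<in>F. derivable Z e"
  shows "\<exists>S. finite S \<and> closed_facts Z S \<and> F \<subseteq> S"
  using assms
proof (induction F rule: finite_induct)
  case empty
  show ?case by (rule exI[of _ "{}"]) (simp add: closed_facts_def)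
next
  case (insert e F)
  have "derivable Z e" and "\<forall>e\<in>F. derivable Z e" using insert.prems by simp_all
  from insert.IH[OF this(2)] obtain S where S: "finite S" "closed_facts Z S" "F \<subseteq> S" by blast
  from \<open>derivable Z e\<close> obtain T where T: "finite T" "closed_facts Z T" "e \<in> T"
    unfolding derivable_finite by blast
  show ?case
    using S T closed_facts_Un[OF S(2) T(2)] by (intro exI[of _ "S \<union> T"]) auto
qed

text \<open>Closed sets are stable under union and justification is monotone, so one closed set
  contains all premises F and remains closed when e is added. Completeness thus becomes a
  rule-by-rule check.\<close>

lemma derivableI:
  assumes "finite F" "\<forall>e\<in>F. derivable Z e" "justified Z F e"
  shows "derivable Z e"
proof -
  obtain S where S: "finite S" "closed_facts Z S" "F \<subseteq> S" using derivable_facts_finite[OF assms(1,2)] by blast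
  have "justified Z (insert e S) e" using S(3) by (intro justified_mono[OF assms(3)]) blast
  moreover have "justified Z (insert e S) d" if "d \<in> S" for d
  proof (rule justified_mono)
    show "justified Z S d" using S(2) that unfolding closed_facts_def by (rule bspec)
  qed blast
  ultimately have "closed_facts Z (insert e S)" by (simp add: closed_facts_def)
  then show ?thesis unfolding derivable_finite using S(1) by (intro exI[of _ "insert e S"]) simp
qed

lemma derivable_eval_factI:
  "finite F \<Longrightarrow> \<forall>e\<in>F. derivable Z e \<Longrightarrow> eval_step Z F c xs y \<Longrightarrow> derivable Z (eval_fact c xs y)"
  by (rule derivableI) (auto simp: justified_def)

lemma derivable_code_factI: "finite F \<Longrightarrow> \<forall>e\<in>F. derivable Z e \<Longrightarrow> code_step F c \<Longrightarrow> derivable Z (code_fact c)"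
  by (rule derivableI) (auto simp: justified_def)

lemma derivable_code: "derivable Z (code_fact (code t))"
proof (induction t)
  case (Comp f gs)
  show ?case
    by (rule derivable_code_factI[of "insert (code_fact (code f)) ((\<lambda>g. code_fact (code g)) ` set gs)"])
      (use Comp in \<open>auto simp: code_step_def code_pair simp del: code.simps\<close>)
next
  case (Prec f g)
  show ?case
    by (rule derivable_code_factI[of "{code_fact (code f), code_fact (code g)}"])
      (use Prec in \<open>auto simp: code_step_def code_pair simp del: code.simps\<close>)
next
  case (Mu f)
  show ?case
    by (rule derivable_code_factI[of "{code_fact (code f)}"])
      (use Mu in \<open>auto simp: code_step_def code_pair simp del: code.simps\<close>)
qed (rule derivable_code_factI[of "{}"]; auto simp: code_step_def code_pair simp del: code.simps)+

lemma derivable_eval: "eval Z t xs y \<Longrightarrow> derivable Z (eval_fact (code t) (list_encode xs) y)"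
proof (induction rule: eval.induct)
  case (ev_zero xs)
  show ?case by (rule derivable_eval_factI[of "{}"]) (auto simp: eval_step_def code_pair simp del: code.simps)
next
  case (ev_succ x xs)
  show ?case
    by (rule derivable_eval_factI[of "{}"])
      (auto simp: eval_step_def code_pair lnth_list_encode[of 0 "x # xs"] llen_list_encode[of "x # xs"]
        simp del: code.simps list_encode.simps)
next
  case (ev_proj i xs)
  then show ?case
    by (intro derivable_eval_factI[of "{}"]) (auto simp: eval_step_def code_pair simp del: code.simps)
next
  case (ev_oracle x xs)
  show ?case
    by (rule derivable_eval_factI[of "{}"])
      (auto simp: eval_step_def code_pair lnth_list_encode[of 0 "x # xs"] llen_list_encode[of "x # xs"]
        simp del: code.simps list_encode.simps)
next
  case (ev_comp ys gs xs f z)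
  let ?F = "insert (eval_fact (code f) (list_encode ys) z)
    ((\<lambda>i. eval_fact (code (gs ! i)) (list_encode xs) (ys ! i)) ` {..<length gs})"
  show ?case
  proof (rule derivable_eval_factI[of ?F])
    show "\<forall>e\<in>?F. derivable Z e" using ev_comp by auto
    show "eval_step Z ?F (code (Comp f gs)) (list_encode xs) z"
      unfolding eval_step_def code_pair
      by (rule disjI2, rule disjI2, rule disjI2, rule disjI2, rule disjI1, rule exI[of _ "code f"],
          rule exI[of _ "list_encode (map code gs)"], rule exI[of _ "list_encode ys"])
        (use ev_comp.hyps in auto)
  qed simp
next
  case (ev_prec0 f xs y g)
  then show ?case
    by (intro derivable_eval_factI[of "{eval_fact (code f) (list_encode xs) y}"])
      (auto simp: eval_step_def code_pair list_encode_Cons simp del: code.simps list_encode.simps)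
next
  case (ev_precS f g n xs y z)
  then show ?case
    by (intro derivable_eval_factI[of "{eval_fact (code (Prec f g)) (list_encode (n # xs)) y, eval_fact (code g) (list_encode (n # y # xs)) z}"])
      (auto simp: eval_step_def code_pair list_encode_Cons simp del: code.simps list_encode.simps)
next
  case (ev_mu f n xs)
  \<comment> \<open>Choosing a positive value for each m below n leaves finitely many
    premises.\<close>
  then obtain h where h: "\<And>m. m < n \<Longrightarrow> derivable Z (eval_fact (code f) (list_encode (m # xs)) (Suc (h m)))"
    by metis
  let ?F = "insert (eval_fact (code f) (list_encode (n # xs)) 0)
    ((\<lambda>m. eval_fact (code f) (list_encode (m # xs)) (Suc (h m))) ` {..<n})"
  show ?case
  proof (rule derivable_eval_factI[of ?F])
    show "\<forall>e\<in>?F. derivable Z e" using ev_mu h by auto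
    show "eval_step Z ?F (code (Mu f)) (list_encode xs) n"
      unfolding eval_step_def code_pair
      by (intro disjI2) (auto simp: list_encode_Cons simp del: list_encode.simps)
  qed simp
qed

lemma derivable_eval_iff: "derivable Z (eval_fact (code t) (list_encode xs) y) \<longleftrightarrow> eval Z t xs y"
  using derivable_eval closed_facts_eval unfolding derivable_finite by metis

lemma derivable_code_iff: "derivable Z (code_fact c) \<longleftrightarrow> (\<exists>t. c = code t)"
  using derivable_code closed_facts_code unfolding derivable_finite by metis

text \<open>The code fact is a separate conjunct because a derivable evaluation need not inspect all
  parts of n: a recursion on 0 never consults its step term.\<close>

lemma mem_jump_iff:
  "n \<in> jump Z \<longleftrightarrow> derivable Z (code_fact n) \<and> (\<exists>y. derivable Z (eval_fact n (list_encode [n]) y))"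
proof
  assume "n \<in> jump Z"
  then obtain t y where n: "n = code t" and "eval Z t [n] y" unfolding jump_def by blast
  then have "derivable Z (eval_fact n (list_encode [n]) y)" by (metis derivable_eval)
  with n show "derivable Z (code_fact n) \<and> (\<exists>y. derivable Z (eval_fact n (list_encode [n]) y))"
    using derivable_code by blast
next
  assume "derivable Z (code_fact n) \<and> (\<exists>y. derivable Z (eval_fact n (list_encode [n]) y))"
  then obtain t y where n: "n = code t" and "derivable Z (eval_fact n (list_encode [n]) y)"
    unfolding derivable_code_iff by blast
  then have "eval Z t [n] y" by (simp only: derivable_eval_iff)
  with n show "n \<in> jump Z" unfolding jump_def by blast
qed

lemma cpt_list_encode2: "cpt X f \<Longrightarrow> cpt X g \<Longrightarrow> cpt X (\<lambda>n. list_encode [f n, g n])"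
  and cpt_list_encode1: "cpt X f \<Longrightarrow> cpt X (\<lambda>n. list_encode [f n])"
  unfolding list_encode_Cons list_encode.simps(1) by (intro cpt_Suc cpt_pair cpt_const; assumption)+

section \<open>Jumps and the hierarchy\<close>

lemma sigma_jump:
  assumes "sigma X k (\<lambda>n. n \<in> Z)" shows "sigma X (Suc k) (\<lambda>n. n \<in> jump Z)"
  unfolding mem_jump_iff
  by (intro sigma_conj sigma_ex sigma_deriv[OF assms] cpt_code_fact cpt_eval_fact cpt_list_encode1 cpt_intros)

text \<open>A total reduction outputs exactly one of 1 and 0, so A and its complement are both
  described by the existence of a derivation.\<close>

lemma turing_le_sigma:
  assumes "sigma X k (\<lambda>n. n \<in> Z)" "turing_le A Z"
  shows "sigma X (Suc k) (\<lambda>n. n \<in> A)" "sigma X (Suc k) (\<lambda>n. n \<notin> A)"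
proof -
  from assms(2) obtain t where t: "\<And>n. eval Z t [n] (if n \<in> A then 1 else 0)"
    unfolding turing_le_def by blast
  have 1: "(\<lambda>n. n \<in> A) = (\<lambda>n. derivable Z (eval_fact (code t) (list_encode [n]) 1))"
    and 0: "(\<lambda>n. n \<notin> A) = (\<lambda>n. derivable Z (eval_fact (code t) (list_encode [n]) 0))"
    unfolding derivable_eval_iff fun_eq_iff using t eval_det[OF t] by (metis zero_neq_one)+
  show "sigma X (Suc k) (\<lambda>n. n \<in> A)"
    unfolding 1 by (intro sigma_deriv[OF assms(1)] cpt_eval_fact cpt_list_encode1 cpt_intros)
  show "sigma X (Suc k) (\<lambda>n. n \<notin> A)"
    unfolding 0 by (intro sigma_deriv[OF assms(1)] cpt_eval_fact cpt_list_encode1 cpt_intros)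
qed

lemma sigma_self: "sigma X 0 (\<lambda>n. n \<in> X)"
  by (simp add: dec_oracle)

section \<open>C.e. relations as Sigma_1 relations\<close>

lemma ce_rel_in_sigma:
  assumes "ce_rel_in X R" shows "sigma X 1 (\<lambda>p. R (pfst p) (psnd p))"
proof -
  from assms obtain t where "\<And>x y. R x y \<longleftrightarrow> (\<exists>z. eval X t [x, y] z)"
    unfolding ce_rel_in_def by blast
  then have R: "R = (\<lambda>x y. \<exists>z. derivable X (eval_fact (code t) (list_encode [x, y]) z))"
    unfolding derivable_eval_iff fun_eq_iff by blast
  show ?thesis unfolding One_nat_def R
    by (intro sigma_ex sigma_deriv[OF sigma_self] cpt_eval_fact cpt_list_encode2 cpt_intros)
qed

text \<open>As f is total, the search for a zero can fail only by running forever; an existential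
  quantifier thus becomes a halting problem.\<close>

lemma recfn_halting:
  assumes "recfn X (Suc k) f"
  shows "\<exists>t. \<forall>xs. length xs = k \<longrightarrow> ((\<exists>z. eval X t xs z) \<longleftrightarrow> (\<exists>m. f (m # xs) = 0))"
proof -
  obtain t where t: "\<And>xs. length xs = Suc k \<Longrightarrow> eval X t xs (f xs)"
    using assms(1) unfolding recfn_def by blast
  have "(\<exists>z. eval X (Mu t) xs z) \<longleftrightarrow> (\<exists>m. f (m # xs) = 0)" if l: "length xs = k" for xs
  proof
    assume "\<exists>z. eval X (Mu t) xs z"
    then obtain z where "eval X t (z # xs) 0" by (blast elim: eval_MuE)
    moreover have "eval X t (z # xs) (f (z # xs))" using t l by simp
    ultimately show "\<exists>m. f (m # xs) = 0" using eval_det by metis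
  next
    assume ex: "\<exists>m. f (m # xs) = 0"
    from eval_Mu_Least[OF t l ex]
    show "\<exists>z. eval X (Mu t) xs z" by blast
  qed
  then show ?thesis by blast
qed

lemma sigma_ce_rel_in:
  assumes "sigma X 1 (\<lambda>p. R (pfst p) (psnd p))" shows "ce_rel_in X R"
proof -
  from sigma_SucE[of X 0] assms obtain Q where Q: "dec X (\<lambda>p. Q (pfst p) (psnd p))"
    "\<And>p. R (pfst p) (psnd p) \<longleftrightarrow> (\<exists>m. \<not> Q p m)"
    by (metis One_nat_def sigma.simps(1))
  have "recfn X (Suc (Suc (Suc 0))) (\<lambda>xs. pair (pair (xs ! 1) (xs ! 2)) (xs ! 0))"
    by (intro recfn_pair recfn_proj) simp_all
  from recfn_cpt[OF dec_def[THEN iffD1, OF Q(1)] this]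
  have "recfn X (Suc (Suc (Suc 0))) (\<lambda>xs. if Q (pair (xs ! 1) (xs ! 2)) (xs ! 0) then 1 else 0)"
    by simp
  from recfn_halting[OF this] obtain t where t: "\<And>xs. length xs = Suc (Suc 0) \<Longrightarrow>
    (\<exists>z. eval X t xs z) \<longleftrightarrow>
    (\<exists>m. (if Q (pair ((m # xs) ! 1) ((m # xs) ! 2)) ((m # xs) ! 0) then 1 else 0) = (0::nat))"
    by blast
  have "R x y \<longleftrightarrow> (\<exists>z. eval X t [x, y] z)" for x y
    using t[of "[x, y]"] Q(2)[of "pair x y"] by (simp add: if_one_zero_eq_0)
  then show ?thesis unfolding ce_rel_in_def by blast
qed

section \<open>Deciding the hierarchy by iterated jumps\<close>

primrec numeral_rf :: "nat \<Rightarrow> rf" where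
  "numeral_rf 0 = Zero"
| "numeral_rf (Suc n) = Comp Succ [numeral_rf n]"

lemma eval_numeral_rf: "eval X (numeral_rf n) xs n"
proof (induction n)
  case (Suc n)
  show ?case unfolding numeral_rf.simps
    by (rule ev_comp[of "[n]"]) (auto simp: Suc intro: ev_succ)
qed (simp add: ev_zero)

text \<open>An instance of the s-m-n theorem: n is built into a term that ignores its input and
  halts iff P n. Its code is computable from n, so one query to the jump decides P n.\<close>

lemma dec_jump:
  assumes "sigma Z 1 P" shows "dec (jump Z) P"
proof -
  from sigma_SucE[of Z 0] assms obtain Q where Q: "dec Z (\<lambda>p. Q (pfst p) (psnd p))"
    "\<And>n. P n \<longleftrightarrow> (\<exists>m. \<not> Q n m)"
    by (metis One_nat_def sigma.simps(1))
  have "recfn Z (Suc (Suc 0)) (\<lambda>xs. pair (xs ! 1) (xs ! 0))"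
    by (intro recfn_pair recfn_proj) simp_all
  from recfn_cpt[OF dec_def[THEN iffD1, OF Q(1)] this]
  have "recfn Z (Suc (Suc 0)) (\<lambda>xs. if Q (xs ! 1) (xs ! 0) then 1 else 0)"
    by simp
  from recfn_halting[OF this] obtain t where t: "\<And>xs. length xs = Suc 0 \<Longrightarrow>
    (\<exists>z. eval Z t xs z) \<longleftrightarrow>
    (\<exists>m. (if Q ((m # xs) ! 1) ((m # xs) ! 0) then 1 else 0) = (0::nat))"
    by blast
  have t1: "(\<exists>z. eval Z t [n] z) \<longleftrightarrow> P n" for n
    using t[of "[n]"] Q(2)[of n] by (simp add: if_one_zero_eq_0)
  let ?s = "\<lambda>n. code (Comp t [numeral_rf n])"
  \<comment> \<open>Independence of the input xs matters because the jump runs the term on its own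
    code.\<close>
  have "(\<exists>z. eval Z (Comp t [numeral_rf n]) xs z) \<longleftrightarrow> (\<exists>z. eval Z t [n] z)" for n xs
  proof
    assume "\<exists>z. eval Z (Comp t [numeral_rf n]) xs z"
    then obtain ys z where "length ys = 1" "eval Z (numeral_rf n) xs (ys ! 0)" "eval Z t ys z"
      by (auto elim: eval_CompE)
    moreover from this have "ys = [n]"
      using eval_det[OF eval_numeral_rf] by (cases ys) auto
    ultimately show "\<exists>z. eval Z t [n] z" by blast
  next
    assume "\<exists>z. eval Z t [n] z"
    then obtain z where z: "eval Z t [n] z" by blast
    have "eval Z (Comp t [numeral_rf n]) xs z"
      by (rule ev_comp[of "[n]"]) (auto simp: z eval_numeral_rf)
    then show "\<exists>z. eval Z (Comp t [numeral_rf n]) xs z" by blast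
  qed
  then have "(\<exists>z. eval Z (Comp t [numeral_rf n]) xs z) \<longleftrightarrow> P n" for n xs
    by (simp only: t1)
  moreover have "?s n \<in> jump Z \<longleftrightarrow> (\<exists>z. eval Z (Comp t [numeral_rf n]) [?s n] z)" for n
    unfolding jump_def by (auto dest: code_inject simp del: code.simps)
  ultimately have iff: "P = (\<lambda>n. ?s n \<in> jump Z)" by (simp del: code.simps)
  \<comment> \<open>The code of a numeral is itself given by primitive recursion;
    \<open>pair 0 0\<close> and \<open>pair 1 0\<close> are the codes of \<open>Zero\<close> and
    \<open>Succ\<close>, and 4 is the tag of a composition.\<close>
  have num: "code (numeral_rf n) =
      rec_nat (pair 0 0) (\<lambda>_ c. pair 4 (pair (pair 1 0) (list_encode [c]))) n" for n
    by (induction n) (simp_all add: code_pair del: code.simps)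
  have "cpt (jump Z) ?s"
    unfolding code_pair list.map num
    by (intro cpt_list_encode1 cpt_rec cpt_intros)
  from dec_subst[OF dec_oracle this] show ?thesis by (simp only: iff)
qed

text \<open>The k-th jump decides the matrix, so P is Sigma_1 in it, and one more jump decides
  P.\<close>

lemma sigma_dec_jump: "sigma X k P \<Longrightarrow> dec ((jump ^^ k) X) P"
proof (induction k arbitrary: P)
  case (Suc k)
  from sigma_SucE[OF Suc.prems] obtain Q where Q: "sigma X k (\<lambda>p. Q (pfst p) (psnd p))"
    "\<And>n. P n \<longleftrightarrow> (\<exists>m. \<not> Q n m)" by blast
  have "sigma ((jump ^^ k) X) 1 P"
    unfolding One_nat_def by (rule sigma_SucI[of _ _ Q]) (simp_all add: Suc.IH[OF Q(1)] Q(2))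
  from dec_jump[OF this] show ?case by simp
qed simp

text \<open>The k-th jump decides both matrices and searches for a witness of P and of its negation
  at once. The search terminates since one of the two holds, and testing Q at the number found tells
  which.\<close>

lemma delta_dec:
  assumes "sigma X (Suc k) P" "sigma X (Suc k) (\<lambda>n. \<not> P n)"
  shows "dec ((jump ^^ k) X) P"
proof -
  let ?Z = "(jump ^^ k) X"
  from sigma_SucE[OF assms(1)] obtain Q where Q: "sigma X k (\<lambda>p. Q (pfst p) (psnd p))"
    "\<And>n. P n \<longleftrightarrow> (\<exists>m. \<not> Q n m)" by blast
  from sigma_SucE[OF assms(2)] obtain Q' where Q': "sigma X k (\<lambda>p. Q' (pfst p) (psnd p))"
    "\<And>n. \<not> P n \<longleftrightarrow> (\<exists>m. \<not> Q' n m)" by blast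
  define w where "w n = (LEAST m. \<not> Q n m \<or> \<not> Q' n m)" for n
  have ex: "\<exists>m. \<not> Q n m \<or> \<not> Q' n m" for n using Q(2) Q'(2) by blast
  have "cpt ?Z w"
    unfolding w_def using ex
    by (intro cpt_Least dec_disj dec_not sigma_dec_jump[OF Q(1)] sigma_dec_jump[OF Q'(1)]) auto
  from dec_subst[OF dec_not[OF sigma_dec_jump[OF Q(1)]] cpt_pair[OF cpt_id this]]
  have "dec ?Z (\<lambda>n. \<not> Q n (w n))" by simp
  moreover have "P = (\<lambda>n. \<not> Q n (w n))"
  proof
    fix n
    show "P n = (\<not> Q n (w n))"
      using LeastI_ex[OF ex[of n]] Q(2)[of n] Q'(2)[of n] unfolding w_def by blast
  qed
  ultimately show ?thesis by simp
qed

section \<open>Disjoint unions of fans\<close>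

definition ratio :: "nat \<Rightarrow> real" where
  "ratio k = real (Suc (pfst k)) / real (Suc (psnd k))"

text \<open>Within a component the elements \<open>j \<le> n\<close> are the tips and the others form the spine. The spine
  is ordered through \<open>ratio\<close>, which takes each positive rational value infinitely often; so distinct
  spine elements of equal value are incomparable, which directedness permits.\<close>

definition fan_less :: "nat \<Rightarrow> nat set \<Rightarrow> nat \<Rightarrow> nat \<Rightarrow> bool" where
  "fan_less n C i j \<longleftrightarrow> n < i \<and> (if n < j then ratio i < ratio j else \<exists>l\<in>C. ratio i < real (Suc l))"

definition fans :: "(nat \<Rightarrow> nat) \<Rightarrow> (nat \<Rightarrow> nat set) \<Rightarrow> nat \<Rightarrow> nat \<Rightarrow> bool" where
  "fans N C x y \<longleftrightarrow> pfst x = pfst y \<and> fan_less (N (pfst x)) (C (pfst x)) (psnd x) (psnd y)"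

lemma ratio_pos: "0 < ratio k"
  by (simp add: ratio_def)

lemma ratio_between:
  assumes "0 \<le> r" "r < s" shows "\<exists>k>n. r < ratio k \<and> ratio k < s"
proof -
  obtain q where q: "q \<in> \<rat>" "r < q" "q < s" using Rats_dense_in_real[OF assms(2)] by blast
  with assms obtain p d :: nat where d: "d \<noteq> 0" "\<bar>q\<bar> = real p / real d"
    using Rats_abs_nat_div_natE by metis
  have q': "q = real p / real d" using d assms q by simp
  have p: "p \<noteq> 0" using q' q assms by (intro notI) simp
  \<comment> \<open>Expanding p / d by n + 2 makes a at least n + 1, which lifts the index
    \<open>pair a b\<close> past n; the subtraction of 1 cancels the \<open>Suc\<close> in
    \<open>ratio\<close>.\<close>
  define a b where "a = p * (n + 2) - 1" and "b = d * (n + 2) - 1"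
  have "0 < p * (n + 2)" "0 < d * (n + 2)" using p d by simp_all
  then have a: "Suc a = p * (n + 2)" and b: "Suc b = d * (n + 2)"
    unfolding a_def b_def by simp_all
  have "ratio (pair a b) = real (p * (n + 2)) / real (d * (n + 2))"
    unfolding ratio_def by (simp only: a b pfst_pair psnd_pair)
  also have "\<dots> = q" unfolding q' of_nat_mult
    by (rule nonzero_mult_divide_mult_cancel_right) simp
  finally have "ratio (pair a b) = q" .
  moreover have "n < pair a b"
  proof -
    have "n + 2 \<le> Suc a" unfolding a using p by (cases p) auto
    with le_pair(1)[of a b] show ?thesis by linarith
  qed
  ultimately show ?thesis using q by blast
qed

lemma fan_less_trans: "fan_less n C i j \<Longrightarrow> fan_less n C j k \<Longrightarrow> fan_less n C i k"
  unfolding fan_less_def by (auto split: if_splits intro: less_trans)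

text \<open>Each initial segment consists of the spine elements with values below a strict bound, or
  of a union of such sets in the case of a tip. Two elements share one of these bounds, and by
  density some value fits strictly between their maximum and it.\<close>

lemma fan_less_between:
  assumes "fan_less n C a j" "fan_less n C b j"
  shows "\<exists>c. fan_less n C c j \<and> fan_less n C a c \<and> fan_less n C b c"
proof (cases "n < j")
  case True
  then obtain c where "n < c" "max (ratio a) (ratio b) < ratio c" "ratio c < ratio j"
    using assms ratio_between[of "max (ratio a) (ratio b)" "ratio j" n] ratio_pos[of a]
    by (auto simp: fan_less_def le_max_iff_disj)
  with True assms show ?thesis unfolding fan_less_def by auto
next
  case False
  with assms obtain l m where lm: "l \<in> C" "ratio a < real (Suc l)" "m \<in> C" "ratio b < real (Suc m)"
    by (auto simp: fan_less_def)
  define k where "k = max l m"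
  have k: "k \<in> C" "max (ratio a) (ratio b) < real (Suc k)" using lm by (auto simp: k_def max_def)
  then obtain c where "n < c" "max (ratio a) (ratio b) < ratio c" "ratio c < real (Suc k)"
    using ratio_between[of "max (ratio a) (ratio b)" "real (Suc k)" n] ratio_pos[of a] by fastforce
  with False assms k(1) show ?thesis unfolding fan_less_def by auto
qed

text \<open>Membership of 0 in C puts all spine values below 1 under the tips; no value is least in
  the spine.\<close>

lemma fan_less_below:
  assumes "0 \<in> C" shows "\<exists>i. fan_less n C i j"
proof (cases "n < j")
  case True
  obtain i where "n < i" "ratio i < ratio j" using ratio_between[of 0 "ratio j" n] ratio_pos by auto
  with True show ?thesis unfolding fan_less_def by auto
next
  case False
  obtain i where "n < i" "ratio i < 1" using ratio_between[of 0 1 n] by auto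
  with False assms show ?thesis unfolding fan_less_def by force
qed

lemma fans_irreflp: "irreflp (fans N C)"
  by (auto intro!: irreflpI simp: fans_def fan_less_def)

lemma fans_interpolable:
  assumes "\<And>c. 0 \<in> C c" shows "interpolable (fans N C)"
  unfolding interpolable_def
proof (intro conjI allI impI)
  show "transp (fans N C)"
    by (rule transpI) (auto simp: fans_def intro: fan_less_trans)
next
  fix y
  obtain i where "fan_less (N (pfst y)) (C (pfst y)) i (psnd y)"
    using fan_less_below[OF assms] by blast
  then show "\<exists>x. fans N C x y" by (intro exI[of _ "pair (pfst y) i"]) (simp add: fans_def)
next
  fix y a b assume "fans N C a y \<and> fans N C b y"
  then have a: "pfst a = pfst y" "fan_less (N (pfst y)) (C (pfst y)) (psnd a) (psnd y)"
    and b: "pfst b = pfst y" "fan_less (N (pfst y)) (C (pfst y)) (psnd b) (psnd y)"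
    by (auto simp: fans_def)
  from fan_less_between[OF a(2) b(2)] obtain c where "fan_less (N (pfst y)) (C (pfst y)) c (psnd y)"
    "fan_less (N (pfst y)) (C (pfst y)) (psnd a) c" "fan_less (N (pfst y)) (C (pfst y)) (psnd b) c"
    by blast
  then show "\<exists>c. fans N C c y \<and> fans N C a c \<and> fans N C b c"
    using a(1) b(1) by (intro exI[of _ "pair (pfst y) c"]) (simp add: fans_def)
qed

section \<open>Isomorphisms by permuting components\<close>

lemma fans_iso:
  assumes "bij p" "\<And>c. N' (p c) = N c" "\<And>c. C' (p c) = C c"
  shows "rel_iso (fans N C) (fans N' C')"
proof -
  define f where "f x = pair (p (pfst x)) (psnd x)" for x
  have "inj f"
    by (rule injI) (metis (no_types) assms(1) bij_is_inj f_def injD pair_collapse pair_inject)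
  moreover have "surj f"
  proof (rule surjI)
    fix y show "f (pair (inv p (pfst y)) (psnd y)) = y"
      using assms(1) by (simp add: f_def bij_is_surj surj_f_inv_f)
  qed
  moreover have "fans N C x y \<longleftrightarrow> fans N' C' (f x) (f y)" for x y
    using assms by (auto simp: fans_def f_def bij_is_inj inj_eq)
  ultimately show ?thesis unfolding rel_iso_def bij_def by blast
qed

lemma rel_iso_sym: "rel_iso R S \<Longrightarrow> rel_iso S R"
proof -
  assume "rel_iso R S"
  then obtain f where f: "bij f" "\<And>x y. R x y \<longleftrightarrow> S (f x) (f y)" unfolding rel_iso_def by blast
  then have "S x y \<longleftrightarrow> R (inv f x) (inv f y)" for x y
    by (simp add: bij_is_surj surj_f_inv_f)
  then show ?thesis unfolding rel_iso_def using bij_imp_bij_inv[OF f(1)] by blast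
qed

text \<open>Non-empty fibres are infinite sets of numbers, so the fibres of g and h over the same
  value are in bijection, and these bijections glue to a permutation. No control over multiplicities
  is needed beyond their being infinite.\<close>

lemma ex_bij_fibres:
  fixes g h :: "nat \<Rightarrow> 'a"
  assumes "range g = range h"
    and "\<And>v. v \<in> range g \<Longrightarrow> infinite {c. g c = v}" "\<And>v. v \<in> range h \<Longrightarrow> infinite {c. h c = v}"
  shows "\<exists>p. bij p \<and> (\<forall>c. h (p c) = g c)"
proof -
  have "\<exists>f. bij_betw f {c. g c = v} {c. h c = v}" if "v \<in> range g" for v
  proof -
    have "bij_betw (enumerate {c. g c = v}) UNIV {c. g c = v}"
      "bij_betw (enumerate {c. h c = v}) UNIV {c. h c = v}"
      using assms that by (simp_all add: bij_enumerate)
    then show ?thesis using bij_betw_inv_into bij_betw_trans by blast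
  qed
  then obtain F where F: "\<And>v. v \<in> range g \<Longrightarrow> bij_betw (F v) {c. g c = v} {c. h c = v}" by metis
  define p where "p c = F (g c) c" for c
  have hp: "h (p c) = g c" for c using bij_betwE[OF F[of "g c"]] by (simp add: p_def)
  have "inj p"
  proof (rule injI)
    fix c d assume eq: "p c = p d"
    then have "g c = g d" using hp by metis
    with eq show "c = d"
      using bij_betw_imp_inj_on[OF F[of "g c"]] by (auto simp: p_def dest: inj_onD)
  qed
  moreover have "surj p"
    unfolding surj_def
  proof
    fix d
    have "h d \<in> range g" using assms(1) by simp
    from bij_betw_imp_surj_on[OF F[OF this]] obtain c where "g c = h d" "d = F (h d) c" by blast
    then show "\<exists>c. d = p c" unfolding p_def by metis
  qed
  ultimately show ?thesis using hp unfolding bij_def by blast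
qed

text \<open>The component with index \<open>pair n (pair b (pair m r))\<close> has \<open>n + 1\<close> tips. The indices with \<open>b = 0\<close>
  supply every bounded cut regardless of \<open>E\<close>, and \<open>r\<close> repeats each component infinitely often.\<close>

definition cuts :: "(nat \<Rightarrow> nat \<Rightarrow> nat \<Rightarrow> bool) \<Rightarrow> nat \<Rightarrow> nat set" where
  "cuts E c = (if pfst (psnd c) = 0 then {..pfst (psnd (psnd c))}
     else {l. \<forall>s<l. E (pfst c) (pfst (psnd (psnd c))) s})"

lemma zero_mem_cuts: "0 \<in> cuts E c"
  by (simp add: cuts_def)

lemma cuts_downward: "l \<in> cuts E c \<Longrightarrow> k \<le> l \<Longrightarrow> k \<in> cuts E c"
  by (auto simp: cuts_def split: if_splits)

text \<open>Bounded cuts are present for every n, so a witness m that fails contributes nothing new;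
  the full cut alone depends on E, and only through the predicate that E defines.\<close>

lemma range_cuts:
  "(n, S) \<in> range (\<lambda>c. (pfst c, cuts E c)) \<longleftrightarrow> (\<exists>K. S = {..K}) \<or> S = UNIV \<and> (\<exists>m. \<forall>s. E n m s)"
proof
  assume "(n, S) \<in> range (\<lambda>c. (pfst c, cuts E c))"
  then obtain c where c: "n = pfst c" "S = cuts E c" by blast
  define m where "m = pfst (psnd (psnd c))"
  show "(\<exists>K. S = {..K}) \<or> S = UNIV \<and> (\<exists>m. \<forall>s. E n m s)"
  proof (cases "pfst (psnd c) = 0 \<or> (\<forall>s. E n m s)")
    case True
    then show ?thesis using c by (auto simp: cuts_def m_def)
  next
    case False
    \<comment> \<open>The condition on l looks only at s below l, so the first failure K still
      belongs to the cut and is its maximum.\<close>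
    define K where "K = (LEAST s. \<not> E n m s)"
    have K: "\<not> E n m K" unfolding K_def by (rule LeastI_ex) (use False in blast)
    have "E n m s" if "s < K" for s using not_less_Least[OF that[unfolded K_def]] by blast
    with K have "(\<forall>s<l. E n m s) \<longleftrightarrow> l \<le> K" for l
      using less_le_trans[of _ l K] by (cases "l \<le> K") (auto simp: not_le)
    then have "S = {..K}" using False c by (auto simp: cuts_def m_def)
    then show ?thesis by blast
  qed
next
  assume "(\<exists>K. S = {..K}) \<or> S = UNIV \<and> (\<exists>m. \<forall>s. E n m s)"
  then consider K where "S = {..K}" | m where "S = UNIV" "\<forall>s. E n m s" by blast
  then show "(n, S) \<in> range (\<lambda>c. (pfst c, cuts E c))"
  proof cases
    case (1 K)
    then show ?thesis by (intro range_eqI[of _ _ "pair n (pair 0 (pair K 0))"]) (simp add: cuts_def)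
  next
    case (2 m)
    then show ?thesis by (intro range_eqI[of _ _ "pair n (pair 1 (pair m 0))"]) (simp add: cuts_def)
  qed
qed

lemma infinite_fibre_cuts:
  assumes "v \<in> range (\<lambda>c. (pfst c, cuts E c))"
  shows "infinite {c. (pfst c, cuts E c) = v}"
proof -
  from assms obtain c where c: "v = (pfst c, cuts E c)" by blast
  define f where "f r = pair (pfst c) (pair (pfst (psnd c)) (pair (pfst (psnd (psnd c))) r))" for r
  have "inj f" by (rule injI) (simp add: f_def)
  then have "infinite (range f)" by (rule range_inj_infinite)
  moreover have "range f \<subseteq> {c. (pfst c, cuts E c) = v}" by (auto simp: f_def c cuts_def)
  ultimately show ?thesis using finite_subset by blast
qed

lemma fans_cuts_iso:
  assumes "\<And>n. (\<exists>m. \<forall>s. E n m s) \<longleftrightarrow> (\<exists>m. \<forall>s. E' n m s)"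
  shows "rel_iso (fans pfst (cuts E)) (fans pfst (cuts E'))"
proof -
  have "range (\<lambda>c. (pfst c, cuts E c)) = range (\<lambda>c. (pfst c, cuts E' c))"
  proof (rule set_eqI)
    fix v :: "nat \<times> nat set"
    obtain n S where "v = (n, S)" by (cases v)
    then show "v \<in> range (\<lambda>c. (pfst c, cuts E c)) \<longleftrightarrow> v \<in> range (\<lambda>c. (pfst c, cuts E' c))"
      by (simp only: range_cuts assms)
  qed
  from ex_bij_fibres[OF this infinite_fibre_cuts infinite_fibre_cuts]
  obtain p where "bij p" "\<And>c. (pfst (p c), cuts E' (p c)) = (pfst c, cuts E c)" by blast
  then show ?thesis by (intro fans_iso[of p]) auto
qed

section \<open>The isomorphism invariant and its complexity\<close>

definition has_fan :: "(nat \<Rightarrow> nat \<Rightarrow> bool) \<Rightarrow> nat \<Rightarrow> bool" where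
  "has_fan R n \<longleftrightarrow> (\<exists>x y. (\<forall>i<Suc n. R x (y i)) \<and> (\<forall>i<Suc n. \<forall>j<i. y i \<noteq> y j) \<and>
     (\<forall>i<Suc n. \<forall>z. \<not> R (y i) z) \<and> (\<forall>z. R x z \<longrightarrow> (\<exists>i<Suc n. z = y i \<or> R z (y i))))"

lemma has_fan_iso: "rel_iso R S \<Longrightarrow> has_fan R n \<Longrightarrow> has_fan S n"
proof -
  assume "rel_iso R S" "has_fan R n"
  then obtain f x y where f: "bij f" "\<And>x y. R x y \<longleftrightarrow> S (f x) (f y)"
    and xy: "\<forall>i<Suc n. R x (y i)" "\<forall>i<Suc n. \<forall>j<i. y i \<noteq> y j"
     "\<forall>i<Suc n. \<forall>z. \<not> R (y i) z" "\<forall>z. R x z \<longrightarrow> (\<exists>i<Suc n. z = y i \<or> R z (y i))"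
    unfolding rel_iso_def has_fan_def by auto
  have surj: "(\<forall>z. Q z) \<longleftrightarrow> (\<forall>z. Q (f z))" for Q
    using bij_is_surj[OF f(1)] by (metis surj_def)
  have eq: "f a = f b \<longleftrightarrow> a = b" for a b using bij_is_inj[OF f(1)] by (simp add: inj_eq)
  show "has_fan S n"
    unfolding has_fan_def
    by (rule exI[of _ "f x"], rule exI[of _ "\<lambda>i. f (y i)"])
      (use xy in \<open>simp add: surj[of "\<lambda>z. \<not> S _ z"] surj[of "\<lambda>z. S _ z \<longrightarrow> _ z"] f(2)[symmetric] eq\<close>)
qed

text \<open>The covering clause detects full cuts: a spine element above x and beyond a bounded cut
  lies below no tip. It also makes the count exact, since with a full cut a tip missing among the y
  i would be above x, different from each y i and below none of them.\<close>

lemma has_fan_fans_iff: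
  assumes C: "\<And>c k l. l \<in> C c \<Longrightarrow> k \<le> l \<Longrightarrow> k \<in> C c"
  shows "has_fan (fans N C) n \<longleftrightarrow> (\<exists>c. N c = n \<and> C c = UNIV)"
proof
  assume "has_fan (fans N C) n"
  then obtain x y where xy: "\<forall>i<Suc n. fans N C x (y i)" "\<forall>i<Suc n. \<forall>j<i. y i \<noteq> y j"
     "\<forall>i<Suc n. \<forall>z. \<not> fans N C (y i) z"
     "\<forall>z. fans N C x z \<longrightarrow> (\<exists>i<Suc n. z = y i \<or> fans N C z (y i))"
    unfolding has_fan_def by auto
  define c where "c = pfst x"
  have yc: "pfst (y i) = c" and x: "N c < psnd x" if "i < Suc n" for i
    using xy(1) that by (auto simp: fans_def fan_less_def c_def)
  have leaf: "psnd (y i) \<le> N c" if i: "i < Suc n" for i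
  proof (rule ccontr)
    assume "\<not> psnd (y i) \<le> N c"
    moreover obtain k where "N c < k" "ratio (psnd (y i)) < ratio k"
      \<comment> \<open>The spine has no maximal element, so a maximal y i has to be a tip.\<close>
      using ratio_between[of "ratio (psnd (y i))" "ratio (psnd (y i)) + 1" "N c"] ratio_pos[of "psnd (y i)"] by auto
    ultimately have "fans N C (y i) (pair c k)" using yc[OF i] by (simp add: fans_def fan_less_def)
    with xy(3) i show False by blast
  qed
  have univ: "C c = UNIV"
  proof (rule ccontr)
    assume "C c \<noteq> UNIV"
    then obtain K where "K \<notin> C c" by blast
    then have K: "l < K" if "l \<in> C c" for l using C that by (meson not_le)
    \<comment> \<open>A spine element with value above \<open>?v\<close> is above x and outside the
      cut.\<close>
    let ?v = "max (ratio (psnd x)) (real (Suc K))"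
    obtain k where k: "N c < k" "?v < ratio k"
      using ratio_between[of ?v "?v + 1" "N c"] by (auto simp: le_max_iff_disj)
    have "fans N C x (pair c k)" using k x[of 0] by (simp add: fans_def fan_less_def c_def)
    then obtain i where i: "i < Suc n" "pair c k = y i \<or> fans N C (pair c k) (y i)" using xy(4) by blast
    have "pair c k \<noteq> y i" using leaf[OF i(1)] k(1) by (metis not_le psnd_pair)
    with i have "fans N C (pair c k) (y i)" by blast
    then obtain l where "l \<in> C c" "ratio k < real (Suc l)"
      using leaf[OF i(1)] by (auto simp: fans_def fan_less_def)
    with K[of l] k(2) show False by simp
  qed
  have "(\<lambda>i. psnd (y i)) ` {..<Suc n} = {..N c}"
  proof
    show "(\<lambda>i. psnd (y i)) ` {..<Suc n} \<subseteq> {..N c}" using leaf by auto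
    show "{..N c} \<subseteq> (\<lambda>i. psnd (y i)) ` {..<Suc n}"
    proof
      fix j assume j: "j \<in> {..N c}"
      obtain l where "ratio (psnd x) < real l" using reals_Archimedean2 by blast
      then have "ratio (psnd x) < real (Suc l)" by simp
      then have "fans N C x (pair c j)" using j x[of 0] univ by (auto simp: fans_def fan_less_def c_def)
      then obtain i where i: "i < Suc n" "pair c j = y i \<or> fans N C (pair c j) (y i)" using xy(4) by blast
      then have "pair c j = y i" using j by (auto simp: fans_def fan_less_def)
      then have "psnd (y i) = j" by (metis psnd_pair)
      with i(1) show "j \<in> (\<lambda>i. psnd (y i)) ` {..<Suc n}" by blast
    qed
  qed
  moreover have "inj_on (\<lambda>i. psnd (y i)) {..<Suc n}"
  proof (rule inj_onI)
    fix i j assume ij: "i \<in> {..<Suc n}" "j \<in> {..<Suc n}" "psnd (y i) = psnd (y j)"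
    then have "y i = y j" using yc by (metis lessThan_iff pair_collapse)
    with xy(2) ij show "i = j" by (metis lessThan_iff linorder_neqE_nat)
  qed
  ultimately have "Suc n = card {..N c}" by (metis card_image card_lessThan)
  then show "\<exists>c. N c = n \<and> C c = UNIV" using univ by auto
next
  assume "\<exists>c. N c = n \<and> C c = UNIV"
  then obtain c where c: "N c = n" "C c = UNIV" by blast
  have arch: "\<exists>l. r < real (Suc l)" for r
    using reals_Archimedean2[of r] by (meson less_trans lessI of_nat_less_iff)
  have below: "fans N C z (pair c i)" if "i < Suc n" "pfst z = c" "n < psnd z" for z i
    using that c arch by (auto simp: fans_def fan_less_def)
  show "has_fan (fans N C) n"
    unfolding has_fan_def
  \<comment> \<open>The witnesses are the first spine index Suc n for x and the tips themselves for
    y.\<close>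
  proof (intro exI conjI)
    show "\<forall>i<Suc n. fans N C (pair c (Suc n)) (pair c i)" using below by simp
    show "\<forall>i<Suc n. \<forall>j<i. pair c i \<noteq> pair c j" by simp
    show "\<forall>i<Suc n. \<forall>z. \<not> fans N C (pair c i) z" using c by (auto simp: fans_def fan_less_def)
    show "\<forall>z. fans N C (pair c (Suc n)) z \<longrightarrow> (\<exists>i<Suc n. z = pair c i \<or> fans N C z (pair c i))"
    proof (intro allI impI)
      fix z assume "fans N C (pair c (Suc n)) z"
      then have z: "pfst z = c" by (simp add: fans_def)
      show "\<exists>i<Suc n. z = pair c i \<or> fans N C z (pair c i)"
      proof (cases "psnd z \<le> n")
        case True
        then show ?thesis using z by (intro exI[of _ "psnd z"]) (metis le_imp_less_Suc pair_collapse)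
      next
        case False
        then show ?thesis using z below[of 0 z] by auto
      qed
    qed
  qed
qed

lemma sigma_has_fan:
  assumes "sigma X 1 (\<lambda>p. R (pfst p) (psnd p))" shows "sigma X 3 (has_fan R)"
proof -
  \<comment> \<open>The closure rules never raise a level by themselves, so R is supplied at each
    level where it occurs below.\<close>
  have R1: "sigma X (Suc 0) (\<lambda>n. R (f n) (g n))" if "cpt X f" "cpt X g" for f g
    using sigma_subst[OF assms cpt_pair[OF that]] by simp
  have R2: "sigma X (Suc (Suc 0)) (\<lambda>n. R (f n) (g n))" if "cpt X f" "cpt X g" for f g
    using sigma_mono[OF R1[OF that]] .
  have R3: "sigma X (Suc (Suc (Suc 0))) (\<lambda>n. R (f n) (g n))" if "cpt X f" "cpt X g" for f g
    using sigma_mono[OF R2[OF that]] .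
  have eq: "sigma X j (\<lambda>n. f n = g n)" if "cpt X f" "cpt X g" for f g j
    using that by (intro sigma_dec dec_eq)
  have neq: "sigma X j (\<lambda>n. f n \<noteq> g n)" if "cpt X f" "cpt X g" for f g j
    using that by (intro sigma_dec dec_not dec_eq)
  let ?Q = "\<lambda>n x M. (\<forall>i<Suc n. R x (lnth M i)) \<and> (\<forall>i<Suc n. \<forall>j<i. lnth M i \<noteq> lnth M j) \<and>
    (\<forall>i<Suc n. \<forall>z. \<not> R (lnth M i) z) \<and>
    \<not> (\<exists>z. R x z \<and> \<not> (\<exists>i<Suc n. z = lnth M i \<or> R z (lnth M i)))"
  let ?x = "\<lambda>p. psnd (pfst p)" and ?y = "\<lambda>p i. lnth (psnd p) i" and ?n = "\<lambda>p. pfst (pfst p)"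
  have "sigma X (Suc (Suc (Suc 0))) (\<lambda>p. \<forall>i<Suc (?n p). R (?x p) (?y p i))"
    by (intro sigma_ball R3 cpt_intros)
  moreover have "sigma X (Suc (Suc (Suc 0))) (\<lambda>p. \<forall>i<Suc (?n p). \<forall>j<i. ?y p i \<noteq> ?y p j)"
    by (intro sigma_ball neq cpt_intros)
  moreover have "sigma X (Suc (Suc (Suc 0))) (\<lambda>p. \<forall>i<Suc (?n p). \<forall>z. \<not> R (?y p i) z)"
    unfolding not_ex[symmetric]
    by (intro sigma_ball sigma_swap_not sigma_ex R2 cpt_intros)
  \<comment> \<open>From the inside out: the bounded search is Sigma_1, its negation Sigma_2, the
    quantifier over z stays there, and the outer negation gives Sigma_3.\<close>
  moreover have "sigma X (Suc (Suc (Suc 0)))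
      (\<lambda>p. \<not> (\<exists>z. R (?x p) z \<and> \<not> (\<exists>i<Suc (?n p). z = ?y p i \<or> R z (?y p i))))"
    by (intro sigma_swap_not sigma_ex sigma_conj sigma_bex sigma_disj R2 R1 eq cpt_intros)
  ultimately have "sigma X (Suc (Suc (Suc 0))) (\<lambda>n. \<exists>x M. ?Q n x M)"
    by (intro sigma_ex sigma_conj)
  also have "(\<lambda>n. \<exists>x M. ?Q n x M) = has_fan R"
  proof (intro ext iffI)
    fix n assume "has_fan R n"
    then obtain x y where xy: "\<forall>i<Suc n. R x (y i)" "\<forall>i<Suc n. \<forall>j<i. y i \<noteq> y j"
      "\<forall>i<Suc n. \<forall>z. \<not> R (y i) z" "\<forall>z. R x z \<longrightarrow> (\<exists>i<Suc n. z = y i \<or> R z (y i))"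
      unfolding has_fan_def by auto
    obtain M where M: "\<forall>i<Suc n. lnth M i = y i" using ex_lnth by blast
    show "\<exists>x M. ?Q n x M"
    proof (rule exI[of _ x], rule exI[of _ M], intro conjI)
      show "\<forall>i<Suc n. R x (lnth M i)" "\<forall>i<Suc n. \<forall>z. \<not> R (lnth M i) z" using xy M by simp_all
      show "\<forall>i<Suc n. \<forall>j<i. lnth M i \<noteq> lnth M j" using xy(2) M by (metis less_trans)
      show "\<not> (\<exists>z. R x z \<and> \<not> (\<exists>i<Suc n. z = lnth M i \<or> R z (lnth M i)))"
        using xy(4) M by metis
    qed
  next
    fix n assume "\<exists>x M. ?Q n x M"
    then obtain x M where "?Q n x M" by blast
    then show "has_fan R n"
      unfolding has_fan_def by (intro exI[of _ x], intro exI[of _ "lnth M"]) blast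
  qed
  finally show ?thesis by (simp only: numeral_3_eq_3)
qed

section \<open>A copy that is c.e. in the oracle\<close>

lemma ratio_less_iff: "ratio i < ratio j \<longleftrightarrow> Suc (pfst i) * Suc (psnd j) < Suc (pfst j) * Suc (psnd i)"
proof -
  have "ratio i < ratio j \<longleftrightarrow>
    real (Suc (pfst i)) * real (Suc (psnd j)) < real (Suc (pfst j)) * real (Suc (psnd i))"
    unfolding ratio_def by (simp add: frac_less_eq divide_less_eq less_divide_eq field_simps del: of_nat_Suc)
  then show ?thesis by (simp only: of_nat_mult[symmetric] of_nat_less_iff)
qed

lemma ratio_less_nat_iff: "ratio i < real l \<longleftrightarrow> Suc (pfst i) < l * Suc (psnd i)"
proof -
  have "ratio i < real l \<longleftrightarrow> real (Suc (pfst i)) < real l * real (Suc (psnd i))"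
    unfolding ratio_def by (simp add: divide_less_eq del: of_nat_Suc)
  then show ?thesis by (simp only: of_nat_mult[symmetric] of_nat_less_iff)
qed

text \<open>Cross-multiplication makes the spine order decidable. E enters only through the cuts
  below the tips, positively and under a bounded universal quantifier, so the relation stays
  Sigma_1.\<close>

lemma ce_fans_cuts:
  assumes "sigma X 1 (\<lambda>q. E (pfst q) (pfst (psnd q)) (psnd (psnd q)))"
  shows "ce_rel_in X (fans pfst (cuts E))"
proof (rule sigma_ce_rel_in)
  have E: "sigma X (Suc 0) (\<lambda>n. E (f n) (g n) (h n))" if "cpt X f" "cpt X g" "cpt X h" for f g h
    using sigma_subst[OF assms cpt_pair[OF that(1) cpt_pair[OF that(2,3)]]] by simp
  have leaf: "(\<exists>l\<in>cuts E c. Q l) \<longleftrightarrow> (\<exists>l. (pfst (psnd c) = 0 \<and> l \<le> pfst (psnd (psnd c)) \<or>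
      pfst (psnd c) \<noteq> 0 \<and> (\<forall>s<l. E (pfst c) (pfst (psnd (psnd c))) s)) \<and> Q l)" for c Q
    by (auto simp: cuts_def)
  have if_eq: "(if a then b else d) \<longleftrightarrow> a \<and> b \<or> \<not> a \<and> d" for a b d by simp
  note rels = sigma_dec[OF dec_eq] sigma_dec[OF dec_not[OF dec_eq]] sigma_dec[OF dec_less]
    sigma_dec[OF dec_not[OF dec_less]] sigma_dec[OF dec_le]
  show "sigma X 1 (\<lambda>p. fans pfst (cuts E) (pfst p) (psnd p))"
    unfolding fans_def fan_less_def leaf if_eq ratio_less_iff ratio_less_nat_iff One_nat_def
    by (intro sigma_conj sigma_disj sigma_ex sigma_ball E rels cpt_intros)
qed

text \<open>The two outer quantifiers are exposed and the innermost one stays inside E, which is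
  therefore c.e. rather than decidable, as the growing cuts allow.\<close>

lemma sigma_3_normal_form:
  assumes "sigma X 3 B"
  shows "\<exists>E. sigma X 1 (\<lambda>q. E (pfst q) (pfst (psnd q)) (psnd (psnd q))) \<and>
    (\<forall>n. B n \<longleftrightarrow> (\<exists>m. \<forall>s. E n m s))"
proof -
  from assms have "sigma X (Suc (Suc (Suc 0))) B" by (simp only: numeral_3_eq_3)
  from sigma_SucE[OF this] obtain Q where Q: "sigma X (Suc (Suc 0)) (\<lambda>p. Q (pfst p) (psnd p))"
    "\<And>n. B n \<longleftrightarrow> (\<exists>m. \<not> Q n m)" by blast
  from sigma_SucE[OF Q(1)] obtain E where E: "sigma X (Suc 0) (\<lambda>p. E (pfst p) (psnd p))"
    "\<And>p. Q (pfst p) (psnd p) \<longleftrightarrow> (\<exists>s. \<not> E p s)" by blast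
  have "cpt X (\<lambda>q. pair (pair (pfst q) (pfst (psnd q))) (psnd (psnd q)))"
    by (intro cpt_intros)
  from sigma_subst[OF E(1) this]
  have "sigma X 1 (\<lambda>q. E (pair (pfst q) (pfst (psnd q))) (psnd (psnd q)))" by simp
  moreover have "B n \<longleftrightarrow> (\<exists>m. \<forall>s. E (pair n m) s)" for n
    using Q(2) E(2)[of "pair n _"] by simp
  ultimately show ?thesis by (intro exI[of _ "\<lambda>n m. E (pair n m)"]) simp
qed

theorem theorem33:
  fixes A :: "nat set"
  shows "\<exists>P :: nat \<Rightarrow> nat \<Rightarrow> bool. irreflp P \<and> interpolable P \<and>
           (\<forall>X :: nat set. turing_le A (jump (jump X)) \<longleftrightarrow> (\<exists>R. ce_rel_in X R \<and> rel_iso R P))"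
proof -
  define B where "B k \<longleftrightarrow> (\<exists>h. k = 2 * h \<and> h \<in> A) \<or> (\<exists>h. k = Suc (2 * h) \<and> h \<notin> A)" for k
  have B_even: "B (2 * h) \<longleftrightarrow> h \<in> A" and B_odd: "B (Suc (2 * h)) \<longleftrightarrow> h \<notin> A" for h
    unfolding B_def by (auto dest: arg_cong[where f = even])
  \<comment> \<open>The relation must not depend on X, so its matrix is B n itself, constant in m
    and s; no computability is required of it.\<close>
  define P where "P = fans pfst (cuts (\<lambda>n m s. B n))"
  have has_fan_P: "has_fan P n \<longleftrightarrow> B n" for n
  proof -
    have "has_fan P n \<longleftrightarrow> (\<exists>c. pfst c = n \<and> cuts (\<lambda>n m s. B n) c = UNIV)"
      unfolding P_def by (rule has_fan_fans_iff[OF cuts_downward])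
    also have "\<dots> \<longleftrightarrow> (n, UNIV) \<in> range (\<lambda>c. (pfst c, cuts (\<lambda>n m s. B n) c))"
      by (auto simp: image_iff)
    also have "\<dots> \<longleftrightarrow> B n"
    proof -
      have "(UNIV :: nat set) \<noteq> {..K}" for K
        using infinite_UNIV_nat finite_atMost[of K] by (intro notI) simp
      then show ?thesis unfolding range_cuts by simp
    qed
    finally show ?thesis .
  qed
  have "turing_le A (jump (jump X)) \<longleftrightarrow> (\<exists>R. ce_rel_in X R \<and> rel_iso R P)" for X
  proof
    assume A: "turing_le A (jump (jump X))"
    \<comment> \<open>Two jumps lead to level 2, and the reduction to X'' adds the third
      level.\<close>
    note A3 = turing_le_sigma[OF sigma_jump[OF sigma_jump[OF sigma_self]] A]
    have A_in: "sigma X (Suc (Suc (Suc 0))) (\<lambda>n. f n \<in> A)" if "cpt X f" for f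
      by (rule sigma_subst[OF A3(1) that])
    have A_notin: "sigma X (Suc (Suc (Suc 0))) (\<lambda>n. f n \<notin> A)" if "cpt X f" for f
      by (rule sigma_subst[OF A3(2) that])
    have "sigma X 3 B"
      unfolding B_def numeral_3_eq_3
      by (intro sigma_disj sigma_ex sigma_conj sigma_dec[OF dec_eq] A_in A_notin cpt_intros)
    from sigma_3_normal_form[OF this] obtain E where
      E: "sigma X 1 (\<lambda>q. E (pfst q) (pfst (psnd q)) (psnd (psnd q)))"
      and B_E: "\<And>n. B n \<longleftrightarrow> (\<exists>m. \<forall>s. E n m s)"
      by blast
    have "rel_iso (fans pfst (cuts E)) P"
      unfolding P_def by (rule fans_cuts_iso) (simp add: B_E)
    then show "\<exists>R. ce_rel_in X R \<and> rel_iso R P"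
      using ce_fans_cuts[OF E] by blast
  next
    assume "\<exists>R. ce_rel_in X R \<and> rel_iso R P"
    then obtain R where R: "ce_rel_in X R" "rel_iso R P" by blast
    have "has_fan R = B"
      using has_fan_iso[OF R(2)] has_fan_iso[OF rel_iso_sym[OF R(2)]] has_fan_P by (intro ext) blast
    with sigma_has_fan[OF ce_rel_in_sigma[OF R(1)]] have B: "sigma X 3 B" by simp
    have "sigma X 3 (\<lambda>h. B (2 * h))" "sigma X 3 (\<lambda>h. B (Suc (2 * h)))"
      by (rule sigma_subst[OF B], intro cpt_intros)+
    then have "sigma X (Suc 2) (\<lambda>h. h \<in> A)" "sigma X (Suc 2) (\<lambda>h. h \<notin> A)"
      unfolding B_even B_odd by simp_all
    then have "dec ((jump ^^ 2) X) (\<lambda>h. h \<in> A)" by (rule delta_dec)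
    then show "turing_le A (jump (jump X))"
      by (simp add: turing_le_dec numeral_2_eq_2)
  qed
  moreover have "irreflp P" "interpolable P"
    unfolding P_def by (rule fans_irreflp) (rule fans_interpolable[OF zero_mem_cuts])
  ultimately show ?thesis by blast
qed

end
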